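(* Let $(1,r,a,t)$ be a level $h$-vector, where $t\geq \frac{r}{2}$. Then $(1,r,b,t)$ is also a level $h$-vector for all integers $b=a,a+1,\dots,\min\left\lbrace t+1,\binom{r+1}{2}\right\rbrace$.
   Context: Let $k$ be a field of characteristic zero. All algebras are standard graded artinian algebras $A=R/I$, where $R=k[x_1,\dots,x_r]$, all $x_i$ have degree $1$, and $I$ is a homogeneous ideal of $R$ containing no nonzero forms of degree $1$. The $h$-vector of $A$ is $h(A)=(h_0,h_1,\dots,h_e)$, where $h_i=\dim_k A_i$ and $e$ is the last index with $\dim_k A_e>0$; thus $h_0=1$ and $h_1=r$. The integer $e$ is the socle degree. The socle of $A$ is the annihilator in $A$ of its homogeneous maximal ideal. $A$ is level of type $t$ if its socle is concentrated in degree $e$ and has dimension $t=h_e$. An $h$-vector is level if it is the $h$-vector of some level standard graded artinian algebra $A=k[x_1,\dots,x_r]/I$, where all $x_i$ have degree $1$ and $I$ is a homogeneous ideal containing no nonzero forms of degree $1$. *)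

theory Defs
  imports
    Complex_Main
    "HOL-Library.Poly_Mapping"
    "HOL-Algebra.QuotRing"
    "HOL-Algebra.Embedded_Algebras"
begin

text \<open>Polynomials are finitely supported maps from exponent vectors to coefficients. The ring in
  the first \<open>n\<close> variables is a carrier in this type, so that \<open>n\<close> may be
  quantified over inside a formula.\<close>

type_synonym monomial = "nat \<Rightarrow>\<^sub>0 nat"
type_synonym 'k mpoly = "monomial \<Rightarrow>\<^sub>0 'k"

definition poly_ring :: "nat \<Rightarrow> ('k::field) mpoly ring" where
  "poly_ring n =
     \<lparr>carrier = {p. \<forall>m \<in> Poly_Mapping.keys p. Poly_Mapping.keys m \<subseteq> {..<n}},
      mult = (*), one = 1, zero = 0, add = (+)\<rparr>"

lemma poly_ring_simps:
  "p \<in> carrier (poly_ring n) \<longleftrightarrow>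
     (\<forall>m \<in> Poly_Mapping.keys p. Poly_Mapping.keys m \<subseteq> {..<n})"
  "p \<otimes>\<^bsub>poly_ring n\<^esub> q = p * q"
  "p \<oplus>\<^bsub>poly_ring n\<^esub> q = p + q"
  "\<one>\<^bsub>poly_ring n\<^esub> = 1"
  "\<zero>\<^bsub>poly_ring n\<^esub> = 0"
  by (simp_all add: poly_ring_def)

lemma poly_ring_closed:
  assumes "p \<in> carrier (poly_ring n)" "q \<in> carrier (poly_ring n)"
  shows "p + q \<in> carrier (poly_ring n)" "p * q \<in> carrier (poly_ring n)"
    "- p \<in> carrier (poly_ring n)"
proof -
  show "p + q \<in> carrier (poly_ring n)"
    using assms Poly_Mapping.keys_add[of p q] unfolding poly_ring_simps by blast
  show "p * q \<in> carrier (poly_ring n)"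
    unfolding poly_ring_simps
  proof (rule ballI)
    fix m assume "m \<in> Poly_Mapping.keys (p * q)"
    then obtain a b where ab: "a \<in> Poly_Mapping.keys p" "b \<in> Poly_Mapping.keys q" "m = a + b"
      using keys_mult[of p q] by blast
    with assms have "Poly_Mapping.keys a \<subseteq> {..<n}" "Poly_Mapping.keys b \<subseteq> {..<n}"
      unfolding poly_ring_simps by blast+
    with Poly_Mapping.keys_add[of a b] ab show "Poly_Mapping.keys m \<subseteq> {..<n}" by blast
  qed
  show "- p \<in> carrier (poly_ring n)"
    using assms unfolding poly_ring_simps by simp
qed

lemma poly_ring_consts:
  "0 \<in> carrier (poly_ring n)" "1 \<in> carrier (poly_ring n)"
  by (simp_all add: poly_ring_simps)

lemma cring_poly_ring: "cring (poly_ring n)"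
proof (rule cringI)
  show "abelian_group (poly_ring n)"
  proof (rule abelian_groupI, goal_cases)
    case (6 p)
    then show ?case
      using poly_ring_closed(3)[of p n p] by (intro bexI[of _ "- p"]) (simp add: poly_ring_simps(3,5))
  qed (simp_all only: poly_ring_simps(2-) poly_ring_closed poly_ring_consts ac_simps add_0_left add_0_right)
  show "Group.comm_monoid (poly_ring n)"
    by (rule comm_monoidI)
      (simp_all only: poly_ring_simps(2-) poly_ring_closed poly_ring_consts ac_simps mult_1_left mult_1_right)
qed (simp only: poly_ring_simps(2-) distrib_right)

definition mdeg :: "monomial \<Rightarrow> nat" where
  "mdeg m = (\<Sum>i \<in> Poly_Mapping.keys m. Poly_Mapping.lookup m i)"

text \<open>As usual, \<open>0\<close> counts as a form of every degree.\<close>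

definition forms :: "nat \<Rightarrow> nat \<Rightarrow> ('k::field) mpoly set" where
  "forms n d = {p \<in> carrier (poly_ring n). \<forall>m \<in> Poly_Mapping.keys p. mdeg m = d}"

definition hom_component :: "nat \<Rightarrow> ('k::field) mpoly \<Rightarrow> 'k mpoly" where
  "hom_component d p = Poly_Mapping.mapp (\<lambda>m c. if mdeg m = d then c else 0) p"

definition homogeneous_ideal :: "nat \<Rightarrow> ('k::field) mpoly set \<Rightarrow> bool" where
  "homogeneous_ideal n I \<longleftrightarrow>
     ideal I (poly_ring n) \<and> (\<forall>p \<in> I. \<forall>d. hom_component d p \<in> I)"

locale artinian_ring = ring +
  assumes descending_chain_condition:
    "(\<And>i. ideal (J i) R) \<Longrightarrow> (\<And>i. J (Suc i) \<subseteq> J i) \<Longrightarrow>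
       \<exists>N. \<forall>i \<ge> N. J i = J (N::nat)"

abbreviation quot_algebra :: "nat \<Rightarrow> ('k::field) mpoly set \<Rightarrow> 'k mpoly set ring" where
  "quot_algebra n I \<equiv> poly_ring n Quot I"

definition standard_graded_artinian :: "nat \<Rightarrow> ('k::field) mpoly set \<Rightarrow> bool" where
  "standard_graded_artinian n I \<longleftrightarrow>
     homogeneous_ideal n I \<and> (\<forall>p \<in> I \<inter> forms n 1. p = 0) \<and>
     artinian_ring (quot_algebra n I)"

definition quot_class :: "nat \<Rightarrow> ('k::field) mpoly set \<Rightarrow> 'k mpoly \<Rightarrow> 'k mpoly set" where
  "quot_class n I p = I +>\<^bsub>poly_ring n\<^esub> p"

text \<open>The image of \<open>k\<close> in \<open>A = R/I\<close>; dimensions over \<open>k\<close> are taken over this subring.\<close>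

definition quot_scalars :: "nat \<Rightarrow> ('k::field) mpoly set \<Rightarrow> 'k mpoly set set" where
  "quot_scalars n I = range (\<lambda>c. quot_class n I (Poly_Mapping.single 0 c))"

definition graded_piece :: "nat \<Rightarrow> ('k::field) mpoly set \<Rightarrow> nat \<Rightarrow> 'k mpoly set set" where
  "graded_piece n I d = quot_class n I ` forms n d"

definition has_dim :: "nat \<Rightarrow> ('k::field) mpoly set \<Rightarrow> 'k mpoly set set \<Rightarrow> nat \<Rightarrow> bool" where
  "has_dim n I V d \<longleftrightarrow> ring.dimension (quot_algebra n I) d (quot_scalars n I) V"

text \<open>The list \<open>h\<close> is \<open>(h\<^sub>0, \<dots>, h\<^sub>e)\<close>, with \<open>e = length h - 1\<close> the socle degree.\<close>

definition is_h_vector :: "nat \<Rightarrow> ('k::field) mpoly set \<Rightarrow> nat list \<Rightarrow> bool" where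
  "is_h_vector n I h \<longleftrightarrow>
     h \<noteq> [] \<and> last h > 0 \<and>
     (\<forall>i < length h. has_dim n I (graded_piece n I i) (h ! i)) \<and>
     (\<forall>i \<ge> length h. has_dim n I (graded_piece n I i) 0)"

definition quot_max_ideal :: "nat \<Rightarrow> ('k::field) mpoly set \<Rightarrow> 'k mpoly set set" where
  "quot_max_ideal n I =
     quot_class n I ` {p \<in> carrier (poly_ring n). Poly_Mapping.lookup p 0 = 0}"

definition quot_socle :: "nat \<Rightarrow> ('k::field) mpoly set \<Rightarrow> 'k mpoly set set" where
  "quot_socle n I =
     {a \<in> carrier (quot_algebra n I). \<forall>x \<in> quot_max_ideal n I.
        x \<otimes>\<^bsub>quot_algebra n I\<^esub> a = \<zero>\<^bsub>quot_algebra n I\<^esub>}"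

definition level_algebra :: "nat \<Rightarrow> ('k::field) mpoly set \<Rightarrow> nat \<Rightarrow> nat \<Rightarrow> bool" where
  "level_algebra n I e t \<longleftrightarrow>
     quot_socle n I \<subseteq> graded_piece n I e \<and> has_dim n I (quot_socle n I) t"

definition level_h_vector :: "('k::field) itself \<Rightarrow> nat list \<Rightarrow> bool" where
  "level_h_vector _ h \<longleftrightarrow>
     (\<exists>n (I :: 'k mpoly set). standard_graded_artinian n I \<and> is_h_vector n I h \<and>
        level_algebra n I (length h - 1) (last h))"

end

theory Submission
  imports Defs
begin

text \<open>By Macaulay duality, a level algebra of socle degree 3 corresponds to a space \<open>W\<close> of cubics on
  which the polynomial ring acts by contraction: \<open>h\<^sub>3 = dim W\<close>, \<open>h\<^sub>2\<close> is the dimension of the span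
  \<open>D W\<close> of the first contractions, and \<open>h\<^sub>1\<close> that of the second ones. Adjoining to \<open>W\<close> the cube of a
  linear form whose square is not in \<open>D W\<close> enlarges \<open>D W\<close> by exactly one dimension, so there is
  \<open>U \<supseteq> W\<close> with \<open>dim D U = b\<close>. A subspace \<open>W'\<close> of \<open>U\<close> with \<open>D W' = D U\<close> is then chosen greedily, one
  cubic at a time. The first cubic is the sum of a nonzero element of \<open>W\<close> and a cube, and
  contributes two dimensions to \<open>D W'\<close>; each further one contributes at least one. Hence
  \<open>b - 1 \<le> t\<close> cubics suffice, and \<open>W'\<close> can be enlarged inside \<open>U\<close> to dimension \<open>t\<close>. The second
  contractions still span all linear forms because \<open>D W \<subseteq> D W'\<close>.\<close>

section \<open>Finite-dimensional subspaces\<close>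

text \<open>Counting one new dimension per generator would only bound the number of cubics by
  \<open>b\<close>, while \<open>b\<close> may equal \<open>t + 1\<close>; the difficulty is to save
  one generator. A cube alone cannot do it, since its contractions span at most a line, and an
  element of \<open>W\<close> may itself be a cube. The sum works because the square of the adjoined
  linear form lies outside \<open>D W\<close>: modulo \<open>D W\<close> only the cube is visible,
  so proportional contractions of the sum would force the element of \<open>W\<close> to be a
  multiple of that very cube, and then the square would lie in \<open>D W\<close> after all. Hence
  that cube has to be in \<open>U\<close> from the start, which requires \<open>a < b\<close>. The
  bound \<open>(r + 1) choose 2\<close> is the number of quadratic monomials; as long as
  \<open>D U\<close> is smaller than the space of quadrics, some square is missing, because squares
  span. Levelness enters through adjointness: contraction is dual to multiplication by a variable,
  so the absence of socle in degree \<open>d\<close> says that the degree \<open>d\<close> piece of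
  the inverse system is spanned by the contractions of the next piece.\<close>

context vector_space begin

lemma subspace_basis:
  assumes "subspace V" "V \<subseteq> span S" "finite S"
  obtains B where "finite B" "B \<subseteq> V" "independent B" "span B = V" "card B = dim V"
proof -
  obtain B where B: "B \<subseteq> V" "independent B" "V \<subseteq> span B" "card B = dim V"
    using basis_exists[of V] by blast
  have "finite B"
    using independent_span_bound[OF assms(3) B(2)] B(1) assms(2) by blast
  moreover have "span B = V"
    using B assms(1) by (simp add: span_minimal subset_antisym)
  ultimately show ?thesis
    using B that by blast
qed

lemma card_independent_le_dim:
  assumes "independent B" "B \<subseteq> W" "subspace W" "W \<subseteq> span S" "finite S"
  shows "finite B" "card B \<le> dim W"
proof -
  obtain C where C: "finite C" "span C = W" "card C = dim W"
    using subspace_basis[OF assms(3-5)] by metis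
  show "finite B" "card B \<le> dim W"
    using independent_span_bound[OF C(1) assms(1)] C assms(2) by auto
qed

lemma subspace_complement:
  assumes V: "subspace V" and W: "subspace W" and VW: "V \<subseteq> W" and S: "W \<subseteq> span S" "finite S"
  obtains B where "finite B" "B \<subseteq> W" "independent B" "span B \<inter> V = {0}" "span (V \<union> B) = W"
    "card B + dim V = dim W"
proof -
  obtain C where C: "finite C" "C \<subseteq> V" "independent C" "span C = V" "card C = dim V"
    using subspace_basis[OF V] VW S by (metis order_trans)
  obtain T where T: "C \<subseteq> T" "T \<subseteq> W" "independent T" "W \<subseteq> span T"
    using maximal_independent_subset_extend[of C W] C VW by blast
  have finT: "finite T" "card T = dim W"
    using card_independent_le_dim(1)[OF T(3,2) W S] T basis_card_eq_dim by auto
  define B where "B = T - C"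
  have indB: "independent B"
    using T(3) unfolding B_def by (rule independent_mono) auto
  \<comment> \<open>Coordinates with respect to \<open>T\<close> are unique: those of
    \<open>x\<close> are supported both in \<open>B\<close> and in \<open>C\<close>, which are
    disjoint.\<close>
  have "x = 0" if "x \<in> span B" "x \<in> span C" for x
  proof -
    have *: "representation T x = representation B x" "representation T x = representation C x"
      using representation_extend[OF T(3)] that B_def T(1) by (metis Diff_subset)+
    have "representation T x b = 0" for b
    proof (cases "b \<in> C")
      case True
      then have "b \<notin> B" by (simp add: B_def)
      then show ?thesis using *(1) representation_ne_zero by metis
    next
      case False
      then show ?thesis using *(2) representation_ne_zero by metis
    qed
    moreover have "x \<in> span T"
      using that(2) T(1) span_mono by blast
    ultimately show "x = 0"
      using sum_nonzero_representation_eq[OF T(3), of x] by simp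
  qed
  then have "span B \<inter> V = {0}"
    using C(4) span_zero by blast
  moreover have "span (V \<union> B) = W"
  proof
    show "span (V \<union> B) \<subseteq> W"
      using VW T(2) W by (intro span_minimal) (auto simp: B_def)
    have "T \<subseteq> V \<union> B" using C(2) by (auto simp: B_def)
    then show "W \<subseteq> span (V \<union> B)"
      using T(4) span_mono by blast
  qed
  moreover have "card B + dim V = dim W"
    using finT T(1) C by (metis B_def card_Diff_subset card_mono le_add_diff_inverse2)
  ultimately show ?thesis
    using that indB finT(1) T(2) unfolding B_def by blast
qed

lemma subspace_dim_mono:
  assumes "subspace V" "subspace W" "V \<subseteq> W" "W \<subseteq> span S" "finite S"
  shows "dim V \<le> dim W"
  using subspace_complement[OF assms] by (metis le_add2)

lemma subspace_eqI_dim: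
  assumes "subspace V" "subspace W" "V \<subseteq> W" "W \<subseteq> span S" "finite S" "dim W \<le> dim V"
  shows "V = W"
proof -
  obtain B where B: "finite B" "span (V \<union> B) = W" "card B + dim V = dim W"
    using subspace_complement[OF assms(1-5)] by metis
  then have "card B = 0" using assms(6) by linarith
  then have "B = {}" using B(1) by simp
  then show ?thesis using B(2) assms(1) by (metis Un_empty_right span_eq_iff)
qed

lemma dim_span_insert:
  assumes "subspace V" "V \<subseteq> span S" "finite S" "x \<notin> V"
  shows "dim (span (insert x V)) = Suc (dim V)"
proof -
  obtain B where B: "finite B" "B \<subseteq> V" "independent B" "span B = V" "card B = dim V"
    using subspace_basis[OF assms(1-3)] .
  have "span (insert x V) = span (insert x B)"
    using B(4) span_Un[of "{x}" V] span_Un[of "{x}" B] span_eq_iff[THEN iffD2, OF assms(1)]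
    by simp
  moreover have "independent (insert x B)"
    using B assms(4) by (simp add: independent_insertI)
  moreover have "x \<notin> B" using B assms(4) by blast
  ultimately show ?thesis
    using B dim_span_eq_card_independent[of "insert x B"] by simp
qed

lemma dim_span_insert_le:
  assumes "subspace V" "V \<subseteq> span S" "finite S"
  shows "dim (span (insert x V)) \<le> Suc (dim V)"
proof (cases "x \<in> V")
  case True
  then show ?thesis using assms(1) by (simp add: insert_absorb span_eq_iff[THEN iffD2])
qed (use dim_span_insert[OF assms] in simp)

lemma intermediate_subspace:
  assumes V: "subspace V" and W: "subspace W" and VW: "V \<subseteq> W" and S: "W \<subseteq> span S" "finite S"
    and k: "dim V \<le> k" "k \<le> dim W"
  obtains X where "subspace X" "V \<subseteq> X" "X \<subseteq> W" "dim X = k"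
proof -
  have "\<exists>X. subspace X \<and> V \<subseteq> X \<and> X \<subseteq> W \<and> dim X = dim V + j" if "dim V + j \<le> dim W" for j
    using that
  proof (induction j)
    case 0
    then show ?case using V VW by auto
  next
    case (Suc j)
    then obtain X where X: "subspace X" "V \<subseteq> X" "X \<subseteq> W" "dim X = dim V + j" by auto
    then obtain x where x: "x \<in> W" "x \<notin> X" using Suc.prems by (metis add_Suc_right not_less_eq_eq order_refl subset_antisym subsetI)
    have "dim (span (insert x X)) = Suc (dim X)"
      using dim_span_insert[OF X(1) _ S(2) x(2)] X(3) S by blast
    moreover have "span (insert x X) \<subseteq> W"
      using x X W by (intro span_minimal) auto
    moreover have "V \<subseteq> span (insert x X)"
      using X(2) span_superset by blast
    ultimately show ?case using X(4) by (intro exI[of _ "span (insert x X)"]) auto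
  qed
  from this[of "k - dim V"] k that show ?thesis by auto
qed

lemma dim_kernel_functional:
  assumes V: "subspace V" "V \<subseteq> span S" "finite S"
    and l: "\<And>x y. l (x + y) = l x + (l y :: 'a)" "\<And>c x. l (scale c x) = c * l x"
  shows "subspace {v \<in> V. l v = 0}" "dim V \<le> Suc (dim {v \<in> V. l v = 0})"
proof -
  let ?K = "{v \<in> V. l v = 0}"
  have l0: "l 0 = 0" using l(2)[of 0 0] by simp
  show K: "subspace ?K"
    using V(1) l l0 by (auto simp: subspace_def)
  show "dim V \<le> Suc (dim ?K)"
  proof (cases "?K = V")
    case False
    then obtain v where v: "v \<in> V" "l v \<noteq> 0" by blast
    have "V \<subseteq> span (insert v ?K)"
    proof
      fix x assume x: "x \<in> V"
      let ?y = "x - scale (l x / l v) v"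
      have "l ?y + l (scale (l x / l v) v) = l x"
        by (subst l(1)[symmetric]) simp
      then have "l ?y = 0" using v l(2) by simp
      moreover have "?y \<in> V"
        using V(1) x v by (simp add: subspace_diff subspace_scale)
      ultimately have "?y \<in> span (insert v ?K)"
        by (intro span_base) simp
      moreover have "scale (l x / l v) v \<in> span (insert v ?K)"
        by (intro span_scale span_base) simp
      ultimately have "?y + scale (l x / l v) v \<in> span (insert v ?K)"
        by (rule span_add)
      then show "x \<in> span (insert v ?K)" by simp
    qed
    moreover have "span (insert v ?K) \<subseteq> V"
      using v V(1) by (intro span_minimal) auto
    ultimately have "V = span (insert v ?K)" by blast
    moreover have "?K \<subseteq> span S" using V(2) by auto
    ultimately show ?thesis
      using dim_span_insert_le[OF K _ V(3), of v] by metis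
  qed simp
qed

text \<open>Every functional lowers the dimension by at most one. The subspace conjunct serves the
  induction, which applies the case of one functional to the previous kernel.\<close>

lemma dim_le_common_kernel:
  assumes V: "subspace V" "V \<subseteq> span S" "finite S" and "finite B"
    and l: "\<And>b x y. l b (x + y) = l b x + (l b y :: 'a)" "\<And>b c x. l b (scale c x) = c * l b x"
  shows "subspace {v \<in> V. \<forall>b\<in>B. l b v = 0} \<and> dim V \<le> dim {v \<in> V. \<forall>b\<in>B. l b v = 0} + card B"
  using \<open>finite B\<close>
proof (induction B)
  case empty
  then show ?case using V by simp
next
  case (insert b B)
  let ?K = "{v \<in> V. \<forall>b\<in>B. l b v = 0}"
  have "{v \<in> V. \<forall>b\<in>insert b B. l b v = 0} = {v \<in> ?K. l b v = 0}" by auto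
  moreover have "?K \<subseteq> span S" using V(2) by auto
  ultimately show ?case
    using dim_kernel_functional[of ?K S "l b"] insert V(3) l by auto
qed

end

section \<open>Polynomials as a vector space with a contraction pairing\<close>

abbreviation unit_mono :: "nat \<Rightarrow> monomial" where
  "unit_mono i \<equiv> Poly_Mapping.single i 1"

abbreviation var :: "nat \<Rightarrow> 'k::field mpoly" where
  "var i \<equiv> Poly_Mapping.single (unit_mono i) 1"

text \<open>Multiplication by a constant polynomial, so that ideals are subspaces at once and
  \<open>quot_class\<close> carries it to multiplication by elements of
  \<open>quot_scalars\<close>.\<close>

definition scal :: "'k::field \<Rightarrow> 'k mpoly \<Rightarrow> 'k mpoly" where
  "scal c p = Poly_Mapping.single 0 c * p"

lemma lookup_scal [simp]: "Poly_Mapping.lookup (scal c p) m = c * Poly_Mapping.lookup p m"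
  by (simp add: scal_def mult_map_scale_conv_mult[symmetric] map.rep_eq when_def)

interpretation mp: vector_space "scal :: 'k::field \<Rightarrow> 'k mpoly \<Rightarrow> 'k mpoly"
  by standard (auto intro!: poly_mapping_eqI simp: lookup_add algebra_simps)

lemma lookup_shift:
  fixes p :: "'k::field mpoly"
  shows "Poly_Mapping.lookup (Poly_Mapping.single a 1 * p) (m + a) = Poly_Mapping.lookup p m"
proof -
  have "Poly_Mapping.lookup (Poly_Mapping.single a 1 * p) (m + a) =
      (\<Sum>l. (\<Sum>q. Poly_Mapping.lookup p q when m + a = l + q) when a = l)"
    by (simp add: lookup_mult lookup_single when_mult)
  also have "\<dots> = (\<Sum>q. Poly_Mapping.lookup p q when m + a = a + q)"
    by simp
  also have "\<dots> = (\<Sum>q. Poly_Mapping.lookup p q when m = q)"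
    by (intro Sum_any.cong) (simp add: add.commute[of m])
  finally show ?thesis by simp
qed

lemma keys_shift:
  fixes p :: "'k::field mpoly"
  shows "Poly_Mapping.keys (Poly_Mapping.single a 1 * p) = (\<lambda>m. m + a) ` Poly_Mapping.keys p"
proof
  show "Poly_Mapping.keys (Poly_Mapping.single a 1 * p) \<subseteq> (\<lambda>m. m + a) ` Poly_Mapping.keys p"
    using keys_mult[of "Poly_Mapping.single a 1" p] by (force simp: add.commute)
  show "(\<lambda>m. m + a) ` Poly_Mapping.keys p \<subseteq> Poly_Mapping.keys (Poly_Mapping.single a 1 * p)"
    by (auto simp: in_keys_iff lookup_shift)
qed

lemma mdeg_add [simp]: "mdeg (a + b) = mdeg a + mdeg b"
  unfolding mdeg_def using setsum_keys_plus_distrib[of "\<lambda>_ x. x" a b] by simp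

lemma mdeg_single [simp]: "mdeg (Poly_Mapping.single i k) = k"
  by (simp add: mdeg_def)

lemma mdeg_0 [simp]: "mdeg 0 = 0"
  by (simp add: mdeg_def)

lemma lookup_le_mdeg: "Poly_Mapping.lookup m i \<le> mdeg m"
proof (cases "i \<in> Poly_Mapping.keys m")
  case True
  then show ?thesis unfolding mdeg_def by (intro member_le_sum) auto
qed (simp add: in_keys_iff)

lemma mdeg_eq_0_iff [simp]: "mdeg m = 0 \<longleftrightarrow> m = 0"
proof
  assume "mdeg m = 0"
  then show "m = 0" using lookup_le_mdeg[of m] by (intro poly_mapping_eqI) simp
qed simp

lemma monomial_cases: "m \<noteq> 0 \<Longrightarrow> \<exists>i\<in>Poly_Mapping.keys m. \<exists>m'. m = m' + unit_mono i"
proof -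
  assume "m \<noteq> 0"
  then obtain i where i: "i \<in> Poly_Mapping.keys m"
    by (metis keys_eq_empty ex_in_conv)
  have "m = (m - unit_mono i) + unit_mono i"
    using i by (intro poly_mapping_eqI) (auto simp: lookup_add lookup_minus lookup_single when_def in_keys_iff)
  then show ?thesis using i by blast
qed

lemma keys_add_monomial: "Poly_Mapping.keys (a + b) = Poly_Mapping.keys a \<union> Poly_Mapping.keys (b :: monomial)"
  by (auto simp: in_keys_iff lookup_add)

definition monoms :: "nat \<Rightarrow> nat \<Rightarrow> monomial set" where
  "monoms n d = {m. Poly_Mapping.keys m \<subseteq> {..<n} \<and> mdeg m = d}"

text \<open>An exponent vector in the set is determined by its values below \<open>n\<close>, and
  each value is at most \<open>d\<close>.\<close>

lemma finite_monoms: "finite (monoms n d)"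
proof -
  let ?f = "\<lambda>m. restrict (Poly_Mapping.lookup m) {..<n}"
  have "inj_on ?f (monoms n d)"
  proof (rule inj_onI, rule poly_mapping_eqI)
    fix a b k
    assume a: "a \<in> monoms n d" and b: "b \<in> monoms n d" and eq: "?f a = ?f b"
    show "Poly_Mapping.lookup a k = Poly_Mapping.lookup b k"
    proof (cases "k < n")
      case True
      then show ?thesis using fun_cong[OF eq, of k] by simp
    next
      case False
      then have "k \<notin> Poly_Mapping.keys a" "k \<notin> Poly_Mapping.keys b"
        using a b by (auto simp: monoms_def)
      then show ?thesis by (simp add: in_keys_iff)
    qed
  qed
  moreover have "?f ` monoms n d \<subseteq> {..<n} \<rightarrow>\<^sub>E {..d}"
    unfolding image_subset_iff restrict_PiE_iff monoms_def using lookup_le_mdeg by auto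
  ultimately show ?thesis
    using finite_imageD finite_subset finite_PiE[of "{..<n}" "\<lambda>_. {..d}"] by blast
qed

lemma forms_iff: "p \<in> forms n d \<longleftrightarrow> Poly_Mapping.keys p \<subseteq> monoms n d"
  by (auto simp: forms_def poly_ring_simps monoms_def)

lemma lookup_form_eq_0: "p \<in> forms n d \<Longrightarrow> m \<notin> monoms n d \<Longrightarrow> Poly_Mapping.lookup p m = 0"
  by (auto simp: forms_iff in_keys_iff)

lemma keys_scal: "Poly_Mapping.keys (scal c p) \<subseteq> Poly_Mapping.keys p"
  by (auto simp: in_keys_iff)

lemma subspace_keys: "mp.subspace {p :: 'k::field mpoly. Poly_Mapping.keys p \<subseteq> M}"
proof (rule mp.subspaceI)
  show "p + q \<in> {p. Poly_Mapping.keys p \<subseteq> M}"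
    if "p \<in> {p. Poly_Mapping.keys p \<subseteq> M}" "q \<in> {p. Poly_Mapping.keys p \<subseteq> M}" for p q :: "'k mpoly"
    using that Poly_Mapping.keys_add[of p q] by blast
  show "scal c p \<in> {p. Poly_Mapping.keys p \<subseteq> M}"
    if "p \<in> {p. Poly_Mapping.keys p \<subseteq> M}" for c and p :: "'k mpoly"
    using that keys_scal[of c p] by blast
qed simp

lemma forms_eq: "forms n d = {p. Poly_Mapping.keys p \<subseteq> monoms n d}"
  using forms_iff by blast

lemma carrier_eq: "carrier (poly_ring n) = {p. Poly_Mapping.keys p \<subseteq> {m. Poly_Mapping.keys m \<subseteq> {..<n}}}"
  unfolding set_eq_iff mem_Collect_eq subset_iff poly_ring_simps Ball_def by blast

lemma subspace_forms: "mp.subspace (forms n d)"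
  unfolding forms_eq by (rule subspace_keys)

lemma subspace_carrier: "mp.subspace (carrier (poly_ring n))"
  unfolding carrier_eq by (rule subspace_keys)

lemma mpoly_eq_sum:
  fixes p :: "'k::field mpoly"
  shows "p = (\<Sum>m\<in>Poly_Mapping.keys p. scal (Poly_Mapping.lookup p m) (Poly_Mapping.single m 1))"
  by (rule poly_mapping_eqI)
    (auto simp: lookup_sum lookup_single when_def in_keys_iff if_distrib cong: if_cong)

lemma keys_subset_span:
  "{p :: 'k::field mpoly. Poly_Mapping.keys p \<subseteq> M} \<subseteq> mp.span ((\<lambda>m. Poly_Mapping.single m 1) ` M)"
proof clarify
  fix p :: "'k mpoly" assume "Poly_Mapping.keys p \<subseteq> M"
  then have "(\<Sum>m\<in>Poly_Mapping.keys p. scal (Poly_Mapping.lookup p m) (Poly_Mapping.single m 1))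
      \<in> mp.span ((\<lambda>m. Poly_Mapping.single m 1) ` M)"
    by (intro mp.span_sum mp.span_scale mp.span_base) auto
  then show "p \<in> mp.span ((\<lambda>m. Poly_Mapping.single m 1) ` M)"
    using mpoly_eq_sum[of p] by simp
qed

definition gens :: "nat \<Rightarrow> nat \<Rightarrow> 'k::field mpoly set" where
  "gens n d = (\<lambda>m. Poly_Mapping.single m 1) ` monoms n d"

lemma finite_gens: "finite (gens n d)"
  by (simp add: gens_def finite_monoms)

lemma forms_subset_span: "forms n d \<subseteq> mp.span (gens n d)"
  unfolding forms_eq gens_def by (rule keys_subset_span)

lemma forms_subset_carrier: "forms n d \<subseteq> carrier (poly_ring n)"
  by (auto simp: forms_def)

lemma lookup_hom_component [simp]:
  "Poly_Mapping.lookup (hom_component d p) m = (if mdeg m = d then Poly_Mapping.lookup p m else 0)"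
  by (auto simp: hom_component_def lookup_mapp when_def in_keys_iff)

lemma hom_component_in_forms: "p \<in> carrier (poly_ring n) \<Longrightarrow> hom_component d p \<in> forms n d"
  by (auto simp: forms_def poly_ring_simps in_keys_iff split: if_splits)

lemma hom_component_form:
  "p \<in> forms n e \<Longrightarrow> hom_component d p = (if d = e then p else 0)"
  by (rule poly_mapping_eqI) (auto simp: forms_def in_keys_iff)

lemma hom_component_diff: "hom_component d (p - q) = hom_component d p - hom_component d q"
  by (rule poly_mapping_eqI) (simp add: lookup_minus)

text \<open>The bilinear form for which the monomials are orthonormal. It carries no factorials, so
  it matches contraction rather than differentiation.\<close>

definition pair :: "'k::field mpoly \<Rightarrow> 'k mpoly \<Rightarrow> 'k" where
  "pair p q = (\<Sum>m\<in>Poly_Mapping.keys p. Poly_Mapping.lookup p m * Poly_Mapping.lookup q m)"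

lemma pair_superset:
  assumes "finite M" "Poly_Mapping.keys p \<subseteq> M"
  shows "pair p q = (\<Sum>m\<in>M. Poly_Mapping.lookup p m * Poly_Mapping.lookup q m)"
  unfolding pair_def using assms by (intro sum.mono_neutral_left) (auto simp: in_keys_iff)

lemma pair_commute: "pair p q = pair q p"
  using pair_superset[of "Poly_Mapping.keys p \<union> Poly_Mapping.keys q" p q]
    pair_superset[of "Poly_Mapping.keys p \<union> Poly_Mapping.keys q" q p]
  by (simp add: mult.commute)

lemma pair_add_right: "pair p (q + r) = pair p q + pair p r"
  by (simp add: pair_def lookup_add algebra_simps sum.distrib)

lemma pair_scal_right: "pair p (scal c q) = c * pair p q"
  by (simp add: pair_def algebra_simps sum_distrib_left)

lemma pair_diff_right: "pair p (q - r) = pair p q - pair p r"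
  by (simp add: pair_def lookup_minus algebra_simps sum_subtractf)

lemma pair_add_left: "pair (q + r) p = pair q p + pair r p"
  by (metis pair_commute pair_add_right)

lemma pair_scal_left: "pair (scal c q) p = c * pair q p"
  by (metis pair_commute pair_scal_right)

lemma pair_0 [simp]: "pair 0 p = 0" "pair p 0 = 0"
  by (simp_all add: pair_def)

lemma pair_single_right: "pair p (Poly_Mapping.single m 1) = Poly_Mapping.lookup p m"
  using pair_superset[of "{m}" "Poly_Mapping.single m 1" p] pair_commute[of p] by simp

lemma pair_nondegenerate:
  assumes "p \<in> forms n d" "\<And>q. q \<in> forms n d \<Longrightarrow> pair p q = 0"
  shows "p = 0"
proof (rule poly_mapping_eqI)
  fix m
  show "Poly_Mapping.lookup p m = Poly_Mapping.lookup 0 m"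
  proof (cases "m \<in> monoms n d")
    case True
    then have "Poly_Mapping.single m (1::'a) \<in> forms n d" by (simp add: forms_iff)
    then show ?thesis using assms(2) pair_single_right[of p m] by simp
  qed (simp add: lookup_form_eq_0[OF assms(1)])
qed

definition ann :: "nat \<Rightarrow> nat \<Rightarrow> 'k::field mpoly set \<Rightarrow> 'k mpoly set" where
  "ann n d V = {p \<in> forms n d. \<forall>q\<in>V. pair q p = 0}"

lemma pair_span_eq_0:
  assumes "\<forall>b\<in>B. pair b p = 0" "q \<in> mp.span B"
  shows "pair q p = 0"
proof -
  have "mp.subspace {q. pair q p = 0}"
    by (auto simp: mp.subspace_def pair_add_left pair_scal_left)
  then have "mp.span B \<subseteq> {q. pair q p = 0}"
    using assms(1) by (intro mp.span_minimal) auto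
  then show ?thesis using assms(2) by blast
qed

lemma ann_span [simp]: "ann n d (mp.span B) = ann n d B"
  unfolding ann_def using pair_span_eq_0 mp.span_superset[of B] by blast

lemma subspace_ann: "mp.subspace (ann n d V)"
  using subspace_forms[of n d]
  by (auto simp: mp.subspace_def ann_def pair_add_right pair_scal_right)

lemma ann_subset_forms: "ann n d V \<subseteq> forms n d"
  by (auto simp: ann_def)

lemma dim_le_pair_kernel:
  assumes "mp.subspace V" "V \<subseteq> mp.span S" "finite S" "finite B"
  shows "mp.dim V \<le> mp.dim {v \<in> V. \<forall>b\<in>B. pair b v = 0} + card B"
  by (rule conjunct2[OF mp.dim_le_common_kernel[OF assms, of pair]])
    (rule pair_add_right, rule pair_scal_right)

text \<open>Two counts. A basis of \<open>V\<close> imposes \<open>mp.dim V\<close> equations on the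
  forms, which bounds the annihilator from below. A complement \<open>C\<close> of the annihilator
  imposes \<open>card C\<close> equations on \<open>V\<close>; only zero satisfies them all, being
  then orthogonal to every form.\<close>

lemma dim_ann:
  fixes V :: "'k::field mpoly set"
  assumes V: "mp.subspace V" "V \<subseteq> forms n d"
  shows "mp.dim (ann n d V) + mp.dim V = mp.dim (forms n d :: 'k mpoly set)"
proof -
  have Vs: "V \<subseteq> mp.span (gens n d)" using V(2) forms_subset_span by blast
  obtain B where B: "finite B" "mp.span B = V" "card B = mp.dim V"
    using mp.subspace_basis[OF V(1) Vs finite_gens] by metis
  have "ann n d V = {v \<in> forms n d. \<forall>b\<in>B. pair b v = 0}"
    using ann_span[of n d B] B(2) by (simp add: ann_def)
  then have le: "mp.dim (forms n d :: 'k mpoly set) \<le> mp.dim (ann n d V) + mp.dim V"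
    using dim_le_pair_kernel[OF subspace_forms forms_subset_span finite_gens B(1), of n d] B(3)
    by simp
  obtain C where C: "finite C" "C \<subseteq> forms n d" "mp.span (ann n d V \<union> C) = forms n d"
    "card C + mp.dim (ann n d V) = mp.dim (forms n d :: 'k mpoly set)"
    by (rule mp.subspace_complement[OF subspace_ann subspace_forms ann_subset_forms
        forms_subset_span finite_gens])
  have "{v \<in> V. \<forall>c\<in>C. pair c v = 0} \<subseteq> {0}"
  proof clarify
    fix v assume v: "v \<in> V" "\<forall>c\<in>C. pair c v = 0"
    have "\<forall>c\<in>ann n d V \<union> C. pair c v = 0"
      using v by (auto simp: ann_def pair_commute[of _ v])
    then have "pair q v = 0" if "q \<in> forms n d" for q
      using pair_span_eq_0[of "ann n d V \<union> C"] C(3) that by simp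
    then have "pair v q = 0" if "q \<in> forms n d" for q
      using that by (simp add: pair_commute[of v])
    then show "v = 0" using pair_nondegenerate V(2) v(1) by blast
  qed
  then have "mp.dim {v \<in> V. \<forall>c\<in>C. pair c v = 0} = 0"
    using mp.dim_le_card[of _ "{}"] by auto
  then have "mp.dim V \<le> card C"
    using dim_le_pair_kernel[OF V(1) Vs finite_gens C(1)] by simp
  then show ?thesis using le C(4) by simp
qed

lemma ann_ann:
  fixes V :: "'k::field mpoly set"
  assumes V: "mp.subspace V" "V \<subseteq> forms n d"
  shows "ann n d (ann n d V) = V"
proof -
  have sub: "V \<subseteq> ann n d (ann n d V)"
    using V(2) by (auto simp: ann_def) (subst pair_commute, blast)
  have dim: "mp.dim (ann n d (ann n d V)) = mp.dim V"
    using dim_ann[OF V] dim_ann[OF subspace_ann ann_subset_forms, of n d V] by linarith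
  have fin: "ann n d (ann n d V) \<subseteq> mp.span (gens n d)"
    using ann_subset_forms forms_subset_span by blast
  show ?thesis
    by (rule mp.subspace_eqI_dim[OF V(1) subspace_ann sub fin finite_gens, symmetric]) (simp add: dim)
qed

text \<open>Contraction by variable \<open>i\<close>: its exponent drops by one without the factor a
  derivative would produce, and monomials free of it are killed.\<close>

definition con :: "nat \<Rightarrow> 'k::field mpoly \<Rightarrow> 'k mpoly" where
  "con i p = Poly_Mapping.map_key (\<lambda>m. m + unit_mono i) p"

lemma lookup_con [simp]: "Poly_Mapping.lookup (con i p) m = Poly_Mapping.lookup p (m + unit_mono i)"
  unfolding con_def by (subst map_key.rep_eq) (auto simp: inj_def)

lemma con_add: "con i (p + q) = con i p + con i q"
  by (rule poly_mapping_eqI) (simp add: lookup_add)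

lemma con_diff: "con i (p - q) = con i p - con i q"
  by (rule poly_mapping_eqI) (simp add: lookup_minus)

lemma con_scal: "con i (scal c p) = scal c (con i p)"
  by (rule poly_mapping_eqI) simp

lemma con_0 [simp]: "con i 0 = 0"
  by (rule poly_mapping_eqI) simp

lemma con_commute: "con i (con j p) = con j (con i p)"
  by (rule poly_mapping_eqI) (simp add: ac_simps)

lemma con_in_forms: "p \<in> forms n (Suc d) \<Longrightarrow> con i p \<in> forms n d"
proof (unfold forms_iff, rule subsetI)
  fix m assume p: "Poly_Mapping.keys p \<subseteq> monoms n (Suc d)" and "m \<in> Poly_Mapping.keys (con i p)"
  then have "m + unit_mono i \<in> monoms n (Suc d)" by (auto simp: in_keys_iff)
  then show "m \<in> monoms n d" by (simp add: monoms_def keys_add_monomial)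
qed

lemma con_in_forms_0: "p \<in> forms n 0 \<Longrightarrow> con i p = 0"
proof (rule poly_mapping_eqI)
  fix k assume p: "p \<in> forms n 0"
  have "mdeg (k + unit_mono i) \<noteq> 0" unfolding mdeg_add by simp
  then have "k + unit_mono i \<notin> monoms n 0" unfolding monoms_def by blast
  then show "Poly_Mapping.lookup (con i p) k = Poly_Mapping.lookup 0 k"
    using lookup_form_eq_0[OF p] by simp
qed

text \<open>Adjointness of contraction and multiplication by a variable. It translates closure of an
  ideal under multiplication into closure of its orthogonal under contraction.\<close>

lemma pair_con: "pair (con i p) q = pair p (var i * q)"
proof -
  have "pair (var i * q) p = (\<Sum>m\<in>(\<lambda>m. m + unit_mono i) ` Poly_Mapping.keys q.
      Poly_Mapping.lookup (var i * q) m * Poly_Mapping.lookup p m)"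
    by (simp add: pair_def keys_shift)
  also have "\<dots> = (\<Sum>m\<in>Poly_Mapping.keys q. Poly_Mapping.lookup q m * Poly_Mapping.lookup p (m + unit_mono i))"
    by (subst sum.reindex) (auto simp: inj_on_def lookup_shift)
  also have "\<dots> = pair q (con i p)" by (simp add: pair_def)
  finally show ?thesis by (metis pair_commute)
qed

section \<open>Spaces of cubics and their derivatives\<close>

text \<open>Every monomial of positive degree contains a variable, so each coefficient reappears in
  one of the contractions.\<close>

lemma forms_eqI_con:
  assumes "p \<in> forms n (Suc d)" "\<And>i. i < n \<Longrightarrow> con i p = 0"
  shows "p = 0"
proof (rule poly_mapping_eqI)
  fix m
  show "Poly_Mapping.lookup p m = Poly_Mapping.lookup 0 m"
  proof (cases "m \<in> monoms n (Suc d)")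
    case True
    then have "m \<noteq> 0" by (auto simp: monoms_def)
    then obtain i m' where i: "i \<in> Poly_Mapping.keys m" and m: "m = m' + unit_mono i"
      using monomial_cases by blast
    have "i < n" using True i by (auto simp: monoms_def)
    then show ?thesis using assms(2)[of i] lookup_con[of i p m'] m by simp
  qed (use lookup_form_eq_0[OF assms(1)] in simp)
qed

definition derivs :: "nat \<Rightarrow> 'k::field mpoly set \<Rightarrow> 'k mpoly set" where
  "derivs n V = mp.span (\<Union>i<n. con i ` V)"

lemma subspace_derivs: "mp.subspace (derivs n V)"
  by (simp add: derivs_def)

lemma con_in_derivs: "p \<in> V \<Longrightarrow> i < n \<Longrightarrow> con i p \<in> derivs n V"
  unfolding derivs_def by (intro mp.span_base) blast

lemma derivs_subset:
  assumes "V \<subseteq> forms n (Suc d)"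
  shows "derivs n V \<subseteq> forms n d"
  unfolding derivs_def
  using assms con_in_forms by (intro mp.span_minimal subspace_forms) blast

lemma derivs_minimal:
  assumes "mp.subspace E" "\<And>p i. p \<in> V \<Longrightarrow> i < n \<Longrightarrow> con i p \<in> E"
  shows "derivs n V \<subseteq> E"
  unfolding derivs_def using assms by (intro mp.span_minimal) auto

lemma derivs_mono: "V \<subseteq> V' \<Longrightarrow> derivs n V \<subseteq> derivs n V'"
  by (rule derivs_minimal[OF subspace_derivs]) (blast intro: con_in_derivs)

lemma con_span:
  assumes "mp.subspace E" "\<And>p. p \<in> B \<Longrightarrow> con i p \<in> E" "q \<in> mp.span B"
  shows "con i q \<in> E"
proof -
  have "mp.subspace {q. con i q \<in> E}"
    using mp.subspace_0[OF assms(1)] mp.subspace_add[OF assms(1)] mp.subspace_scale[OF assms(1)]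
    by (intro mp.subspaceI) (simp_all add: con_add con_scal)
  then have "mp.span B \<subseteq> {q. con i q \<in> E}"
    using assms(2) by (intro mp.span_minimal) auto
  then show ?thesis using assms(3) by blast
qed

lemma derivs_span: "derivs n (mp.span B) = derivs n B"
proof
  show "derivs n (mp.span B) \<subseteq> derivs n B"
    by (rule derivs_minimal[OF subspace_derivs])
      (rule con_span[OF subspace_derivs con_in_derivs])
  show "derivs n B \<subseteq> derivs n (mp.span B)"
    by (rule derivs_mono[OF mp.span_superset])
qed

text \<open>Pairing with \<open>pow_form n d S\<close> evaluates a form at the indicator vector of \<open>S\<close>. Since contraction stands in for differentiation, these elements play the role of the powers
  of linear forms.\<close>

definition pow_form :: "nat \<Rightarrow> nat \<Rightarrow> nat set \<Rightarrow> 'k::field mpoly" where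
  "pow_form n d S = (\<Sum>m \<in> {m \<in> monoms n d. Poly_Mapping.keys m \<subseteq> S}. Poly_Mapping.single m 1)"

lemma lookup_pow_form:
  "Poly_Mapping.lookup (pow_form n d S) m =
     (if m \<in> monoms n d \<and> Poly_Mapping.keys m \<subseteq> S then 1 else 0)"
  by (simp add: pow_form_def lookup_sum lookup_single when_def finite_monoms)

lemma pow_form_in_forms: "pow_form n d S \<in> forms n d"
  by (auto simp: forms_iff lookup_pow_form in_keys_iff split: if_splits)

text \<open>Multiplying a form by variable \<open>i\<close> multiplies its value at the indicator
  vector of \<open>S\<close> by 1 or by 0; this is the dual statement.\<close>

lemma con_pow_form:
  assumes "i < n"
  shows "con i (pow_form n (Suc d) S) = (if i \<in> S then pow_form n d S else 0)"
  using assms by (intro poly_mapping_eqI) (auto simp: lookup_pow_form monoms_def keys_add_monomial)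

lemma pow_form_empty: "pow_form n (Suc d) {} = 0"
  by (rule poly_mapping_eqI) (auto simp: lookup_pow_form monoms_def)

lemma monoms_2_cases:
  assumes "m \<in> monoms n 2"
  obtains i j where "i < n" "j < n" "m = unit_mono i + unit_mono j"
proof -
  have "m \<noteq> 0" using assms by (auto simp: monoms_def)
  then obtain i m' where i: "m = m' + unit_mono i"
    using monomial_cases by blast
  then have "mdeg m' = 1" using assms by (simp add: monoms_def)
  then have "m' \<noteq> 0" by auto
  then obtain j m'' where j: "m' = m'' + unit_mono j"
    using monomial_cases by blast
  then have "mdeg m'' = 0" using \<open>mdeg m' = 1\<close> by simp
  then have m: "m = unit_mono i + unit_mono j" using i j by (simp add: add.commute)
  moreover have "i < n" "j < n"
    using assms unfolding m by (auto simp: monoms_def keys_add_monomial)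
  ultimately show ?thesis using that by blast
qed

lemma monoms_2_supported:
  assumes "i < n" "j < n"
  shows "{m \<in> monoms n 2. Poly_Mapping.keys m \<subseteq> {i, j}} = {unit_mono i + unit_mono i, unit_mono j + unit_mono j, unit_mono i + unit_mono j}"
    (is "?A = ?B")
proof
  show "?A \<subseteq> ?B"
  proof
    fix m assume m: "m \<in> ?A"
    then obtain a b where ab: "m = unit_mono a + unit_mono b" by (blast elim: monoms_2_cases)
    then have "a \<in> {i, j}" "b \<in> {i, j}" using m by (auto simp: keys_add_monomial)
    then show "m \<in> ?B" using ab by (auto simp: add.commute)
  qed
  show "?B \<subseteq> ?A"
    using assms by (auto simp: monoms_def keys_add_monomial)
qed

text \<open>Polarization with indicator vectors only: \<open>{i}\<close> yields a square monomial,
  and \<open>{i, j}\<close> yields two square monomials plus the mixed one with coefficient 1, so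
  nothing is divided by 2.\<close>

lemma quadrics_spanned_by_squares:
  "(forms n 2 :: 'k::field mpoly set) \<subseteq> mp.span (pow_form n 2 ` Pow {..<n})" (is "_ \<subseteq> ?E")
proof -
  have sq: "pow_form n 2 {i, j} \<in> ?E" if "i < n" "j < n" for i j
    using that by (intro mp.span_base) auto
  have diag: "Poly_Mapping.single (unit_mono i + unit_mono i) (1::'k) \<in> ?E" if "i < n" for i
    using sq[OF that that] monoms_2_supported[OF that that] by (simp add: pow_form_def)
  have "Poly_Mapping.single m (1::'k) \<in> ?E" if m2: "m \<in> monoms n 2" for m
  proof -
    obtain i j where ij: "i < n" "j < n" and m: "m = unit_mono i + unit_mono j"
      using monoms_2_cases[OF m2] .
    show ?thesis
    proof (cases "i = j")
      case True
      then show ?thesis using diag ij m by simp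
    next
      case False
      have ne: "unit_mono i + unit_mono i \<noteq> unit_mono j + unit_mono j" "unit_mono i + unit_mono i \<noteq> unit_mono i + unit_mono j" "unit_mono j + unit_mono j \<noteq> unit_mono i + unit_mono j"
        using False by (auto simp: poly_mapping_eq_iff fun_eq_iff lookup_add lookup_single when_def)
      have "pow_form n 2 {i, j} = Poly_Mapping.single (unit_mono i + unit_mono i) (1::'k)
          + (Poly_Mapping.single (unit_mono j + unit_mono j) 1 + Poly_Mapping.single m 1)"
        unfolding pow_form_def monoms_2_supported[OF ij] m
        using ne by simp
      then have "Poly_Mapping.single m (1::'k) = pow_form n 2 {i, j}
          - Poly_Mapping.single (unit_mono i + unit_mono i) 1 - Poly_Mapping.single (unit_mono j + unit_mono j) 1"
        by simp
      then show ?thesis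
        using sq[OF ij] diag ij by (simp add: mp.span_diff)
    qed
  qed
  then have "mp.span ((\<lambda>m. Poly_Mapping.single m 1) ` monoms n 2) \<subseteq> ?E"
    by (intro mp.span_minimal) auto
  then show ?thesis
    using forms_subset_span unfolding gens_def by blast
qed

lemma ex_square_notin:
  fixes V :: "'k::field mpoly set"
  assumes "mp.subspace V" "V \<subseteq> forms n 2" "V \<noteq> forms n 2"
  obtains S where "S \<subseteq> {..<n}" "pow_form n 2 S \<notin> V"
proof -
  have "\<not> pow_form n 2 ` Pow {..<n} \<subseteq> V"
    using mp.span_minimal[OF _ assms(1)] quadrics_spanned_by_squares assms(2,3) by blast
  then show ?thesis using that by auto
qed

text \<open>For empty \<open>S\<close> the square is zero and would lie in \<open>V\<close>.
  Contraction by the index obtained turns the cube of \<open>S\<close> into its square.\<close>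

lemma pow_form_notin_obtain:
  assumes "mp.subspace V" "S \<subseteq> {..<n}" "pow_form n 2 S \<notin> V"
  obtains i where "i \<in> S" "i < n"
proof -
  have "S \<noteq> {}"
    using assms(1,3) pow_form_empty[of n 1] mp.subspace_0 by (metis One_nat_def Suc_1)
  then show ?thesis using assms(2) that by blast
qed

text \<open>Every contraction of the cube is zero or one and the same square, and since
  \<open>S\<close> is nonempty the square does occur.\<close>

lemma derivs_insert_cube:
  fixes V :: "'k::field mpoly set"
  assumes S: "S \<subseteq> {..<n}" "pow_form n 2 S \<notin> derivs n V"
  shows "derivs n (mp.span (insert (pow_form n 3 S) V))
    = mp.span (insert (pow_form n 2 S) (derivs n V))" (is "_ = ?E")
proof -
  obtain i0 where i0: "i0 \<in> S" "i0 < n"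
    using pow_form_notin_obtain[OF subspace_derivs S] .
  have con: "con i (pow_form n 3 S :: 'k mpoly) = (if i \<in> S then pow_form n 2 S else 0)" if "i < n" for i
    using con_pow_form[OF that, of 2 S] by (simp add: eval_nat_numeral)
  have "derivs n (insert (pow_form n 3 S) V) \<subseteq> ?E"
    by (intro derivs_minimal) (auto simp: con mp.span_base mp.span_zero con_in_derivs)
  moreover have "pow_form n 2 S \<in> derivs n (insert (pow_form n 3 S) V)"
    using con[OF i0(2)] i0 con_in_derivs[of "pow_form n 3 S :: 'k mpoly" "insert (pow_form n 3 S) V" i0 n] by simp
  then have "?E \<subseteq> derivs n (insert (pow_form n 3 S) V)"
    using derivs_mono[of V "insert (pow_form n 3 S) V" n]
    by (intro mp.span_minimal subspace_derivs) auto
  ultimately show ?thesis by (simp add: derivs_span)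
qed

text \<open>Each adjoined cube raises the dimension by exactly one, so no value is skipped, and a
  missing square exists until all quadrics are reached.\<close>

lemma enlarge_derivs:
  fixes W :: "'k::field mpoly set"
  assumes W: "mp.subspace W" "W \<subseteq> forms n 3"
    and b: "mp.dim (derivs n W) \<le> b" "b \<le> mp.dim (forms n 2 :: 'k mpoly set)"
  obtains U where "mp.subspace U" "W \<subseteq> U" "U \<subseteq> forms n 3" "mp.dim (derivs n U) = b"
proof -
  have "\<exists>U. mp.subspace U \<and> W \<subseteq> U \<and> U \<subseteq> forms n 3 \<and> mp.dim (derivs n U) = b"
    using b
  proof (induction b rule: dec_induct)
    case base
    then show ?case using W by auto
  next
    case (step b)
    then obtain U where U: "mp.subspace U" "W \<subseteq> U" "U \<subseteq> forms n 3" "mp.dim (derivs n U) = b"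
      by auto
    have D: "derivs n U \<subseteq> forms n 2"
      using derivs_subset[of U n 2] U(3) by (simp add: eval_nat_numeral)
    have "derivs n U \<noteq> forms n 2" using U(4) step.prems by auto
    then obtain S where S: "S \<subseteq> {..<n}" "pow_form n 2 S \<notin> derivs n U"
      using ex_square_notin[OF subspace_derivs D] by blast
    let ?U = "mp.span (insert (pow_form n 3 S) U)"
    have "mp.dim (derivs n ?U) = Suc b"
      using mp.dim_span_insert[OF subspace_derivs _ finite_gens S(2), of n 2]
        D forms_subset_span U(4) derivs_insert_cube[OF S] by auto
    moreover have "?U \<subseteq> forms n 3"
      using U(3) pow_form_in_forms by (intro mp.span_minimal subspace_forms) auto
    moreover have "W \<subseteq> ?U" using U(2) mp.span_superset by blast
    ultimately show ?case by (intro exI[of _ ?U]) simp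
  qed
  then show ?thesis using that by blast
qed

text \<open>Scalar multiples of \<open>pow_form n d S\<close> are recognised by their contractions.\<close>

lemma pure_form_eq_0:
  assumes "H \<in> forms n d" "i0 \<in> S" "i0 < n"
    and "\<And>i. i < n \<Longrightarrow> con i H = (if i \<in> S then con i0 H else 0)"
    and "Poly_Mapping.lookup H (Poly_Mapping.single i0 d) = 0"
  shows "H = 0"
  using assms(1,4,5)
proof (induction d arbitrary: H)
  case 0
  show ?case
  proof (rule poly_mapping_eqI)
    fix m show "Poly_Mapping.lookup H m = Poly_Mapping.lookup 0 m"
      using 0(1,3) lookup_form_eq_0[OF 0(1), of m] by (cases "m = 0") (auto simp: monoms_def)
  qed
next
  case (Suc d)
  \<comment> \<open>Contractions commute, so \<open>con i0 H\<close> inherits the hypotheses; once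
    it vanishes, all contractions of \<open>H\<close> do.\<close>
  have "con i0 H = 0"
  proof (rule Suc.IH)
    show "con i0 H \<in> forms n d" using Suc.prems(1) by (rule con_in_forms)
    show "con i (con i0 H) = (if i \<in> S then con i0 (con i0 H) else 0)" if "i < n" for i
      using Suc.prems(2)[OF that] by (subst con_commute) simp
    show "Poly_Mapping.lookup (con i0 H) (Poly_Mapping.single i0 d) = 0"
      using Suc.prems(3) by (simp add: single_add[symmetric])
  qed
  then show ?case
    using forms_eqI_con[OF Suc.prems(1)] Suc.prems(2) by simp
qed

text \<open>Suppose the contractions of the sum lie on a line. Comparing multiples of the square
  modulo \<open>derivs n W\<close> shows that \<open>G\<close> contracts with the same pattern as
  the cube, so \<open>G\<close> is a nonzero multiple of the cube. Then a contraction of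
  \<open>G\<close> puts the square into \<open>derivs n W\<close>.\<close>

lemma derivs_add_cube_dim:
  fixes W :: "'k::field mpoly set"
  assumes W: "mp.subspace W" and G: "G \<in> W" "G \<noteq> 0" "G \<in> forms n 3"
    and S: "S \<subseteq> {..<n}" "pow_form n 2 S \<notin> derivs n W"
  shows "2 \<le> mp.dim (derivs n {G + pow_form n 3 S})"
proof (rule ccontr)
  let ?c = "pow_form n 3 S :: 'k mpoly" and ?q = "pow_form n 2 S :: 'k mpoly"
  let ?F = "G + ?c"
  assume dim: "\<not> 2 \<le> mp.dim (derivs n {?F})"
  obtain i0 where i0: "i0 \<in> S" "i0 < n"
    using pow_form_notin_obtain[OF subspace_derivs S] .
  have con: "con i ?c = (if i \<in> S then ?q else 0)" if "i < n" for i
    using con_pow_form[OF that, of 2 S] by (simp add: eval_nat_numeral)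
  have conG: "con i G \<in> derivs n W" if "i < n" for i
    using con_in_derivs[OF G(1) that] .
  have D: "derivs n {?F} \<subseteq> mp.span (gens n 2)"
    using derivs_subset[of "{?F}" n 2] G(3) pow_form_in_forms[of n 3 S] forms_subset_span
      mp.subspace_add[OF subspace_forms[of n 3]] by (fastforce simp: eval_nat_numeral)
  have F0: "con i0 ?F = con i0 G + ?q" using con[OF i0(2)] i0 by (simp add: con_add)
  \<comment> \<open>Otherwise the square would be the negative of a contraction of \<open>G\<close>.
    Being nonzero, this contraction spans the supposed line.\<close>
  have "con i0 ?F \<noteq> 0"
  proof
    assume "con i0 ?F = 0"
    then have "?q = - con i0 G" unfolding F0 by (metis minus_unique)
    then show False using S(2) conG[OF i0(2)] mp.subspace_neg[OF subspace_derivs] by metis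
  qed
  then have "mp.dim (mp.span {con i0 ?F}) = 1"
    using mp.dim_span_eq_card_independent[of "{con i0 ?F}"] by simp
  moreover have "mp.span {con i0 ?F} \<subseteq> derivs n {?F}"
    using con_in_derivs[of ?F "{?F}" i0 n] i0 by (intro mp.span_minimal subspace_derivs) auto
  ultimately have eq: "mp.span {con i0 ?F} = derivs n {?F}"
    using mp.subspace_eqI_dim[OF mp.subspace_span subspace_derivs _ D finite_gens] dim by simp
  have pure: "con i G = (if i \<in> S then con i0 G else 0)" if i: "i < n" for i
  proof -
    have "con i ?F \<in> mp.span {con i0 ?F}"
      unfolding eq using con_in_derivs[of ?F "{?F}" i n] i by simp
    then obtain l where l: "con i ?F = scal l (con i0 ?F)"
      by (auto simp: mp.span_singleton)
    \<comment> \<open>The factor of the square contributed by the cube. As the square is outside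
      \<open>derivs n W\<close>, the factor \<open>l\<close> must equal it.\<close>
    define u :: 'k where "u = (if i \<in> S then 1 else 0)"
    have "con i ?F = con i G + scal u ?q"
      using con[OF i] by (simp add: con_add u_def)
    then have l': "con i G + scal u ?q = scal l (con i0 G) + scal l ?q"
      using l unfolding F0 by (simp add: mp.scale_right_distrib)
    then have "scal (u - l) ?q = scal l (con i0 G) - con i G"
      by (simp add: mp.scale_left_diff_distrib algebra_simps)
    then have mem: "scal (u - l) ?q \<in> derivs n W"
      using conG i i0 subspace_derivs mp.subspace_scale mp.subspace_diff by metis
    have "u = l"
    proof (rule ccontr)
      assume "u \<noteq> l"
      then have "?q = scal (inverse (u - l)) (scal (u - l) ?q)" by simp
      then show False using S(2) mem mp.subspace_scale[OF subspace_derivs] by metis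
    qed
    then have "con i G = scal u (con i0 G)" using l' by simp
    then show ?thesis by (simp add: u_def)
  qed
  \<comment> \<open>The cube has coefficient 1 at this monomial, so \<alpha> is the only candidate
    for the ratio of \<open>G\<close> to the cube.\<close>
  define \<alpha> where "\<alpha> = Poly_Mapping.lookup G (Poly_Mapping.single i0 3)"
  have "G + scal (- \<alpha>) ?c = 0"
  proof (rule pure_form_eq_0[of _ n 3 i0 S])
    show "G + scal (- \<alpha>) ?c \<in> forms n 3"
      using G(3) pow_form_in_forms subspace_forms mp.subspace_add mp.subspace_scale by metis
    show "con i (G + scal (- \<alpha>) ?c) = (if i \<in> S then con i0 (G + scal (- \<alpha>) ?c) else 0)"
      if "i < n" for i
      using pure[OF that] con[OF that] con[OF i0(2)] i0 
      by (simp add: con_diff con_scal)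
    show "Poly_Mapping.lookup (G + scal (- \<alpha>) ?c) (Poly_Mapping.single i0 3) = 0"
      using i0 by (simp add: lookup_minus \<alpha>_def lookup_pow_form monoms_def)
  qed (use i0 in auto)
  then have "con i0 (G + scal (- \<alpha>) ?c) = 0" by simp
  then have q: "con i0 G = scal \<alpha> ?q"
    using con[OF i0(2)] i0 by (simp add: con_diff con_scal)
  have "\<alpha> \<noteq> 0" using \<open>G + scal (- \<alpha>) ?c = 0\<close> G(2) by auto
  then have "?q = scal (inverse \<alpha>) (con i0 G)" unfolding q by simp
  then show False
    using S(2) conG[OF i0(2)] mp.subspace_scale[OF subspace_derivs] by metis
qed

text \<open>Each added generator raises the dimension of the derived space by at least one, so an initial
  surplus \<open>e\<close> of derivatives over generators is never lost.\<close>

lemma derivs_generators: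
  fixes U :: "'k::field mpoly set"
  assumes U: "mp.subspace U" "U \<subseteq> forms n (Suc d)"
    and Y: "mp.subspace Y" "Y \<subseteq> U" "mp.dim Y + e \<le> mp.dim (derivs n Y)"
  obtains Y' where "mp.subspace Y'" "Y' \<subseteq> U" "derivs n Y' = derivs n U"
    "mp.dim Y' + e \<le> mp.dim (derivs n U)"
proof -
  have fin: "V \<subseteq> mp.span (gens n (Suc d))" "derivs n V \<subseteq> mp.span (gens n d)" if "V \<subseteq> U" for V
    using that U(2) derivs_subset[of V n d] forms_subset_span by blast+
  have "\<exists>Y'. mp.subspace Y' \<and> Y' \<subseteq> U \<and> derivs n Y' = derivs n U \<and>
      mp.dim Y' + e \<le> mp.dim (derivs n U)"
    using Y
  proof (induction "mp.dim (derivs n U) - mp.dim (derivs n Y)" arbitrary: Y rule: less_induct)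
    case (less Y)
    show ?case
    proof (cases "derivs n Y = derivs n U")
      case True
      then show ?thesis using less.prems by auto
    next
      case False
      have "\<exists>F\<in>U. \<exists>i<n. con i F \<notin> derivs n Y"
      proof (rule ccontr)
        assume "\<not> ?thesis"
        then have "derivs n U \<subseteq> derivs n Y" by (intro derivs_minimal subspace_derivs) blast
        then show False using derivs_mono[OF less.prems(2), of n] False by blast
      qed
      then obtain F i where F: "F \<in> U" "i < n" "con i F \<notin> derivs n Y" by blast
      let ?Y = "mp.span (insert F Y)"
      have Y1: "?Y \<subseteq> U" using F(1) less.prems(2) U(1) by (intro mp.span_minimal) auto
      have sub: "mp.span (insert (con i F) (derivs n Y)) \<subseteq> derivs n ?Y"
        using con_in_derivs[of F "insert F Y" i n] F(2) derivs_mono[of Y "insert F Y" n]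
        by (intro mp.span_minimal subspace_derivs) (auto simp: derivs_span)
      have "Suc (mp.dim (derivs n Y)) = mp.dim (mp.span (insert (con i F) (derivs n Y)))"
        using mp.dim_span_insert[OF subspace_derivs fin(2)[OF less.prems(2)] finite_gens F(3)] by simp
      also have "\<dots> \<le> mp.dim (derivs n ?Y)"
        using mp.subspace_dim_mono[OF mp.subspace_span subspace_derivs sub fin(2)[OF Y1] finite_gens] .
      finally have d: "Suc (mp.dim (derivs n Y)) \<le> mp.dim (derivs n ?Y)" .
      \<comment> \<open>The induction measure is a truncated difference; this bound ensures that it
        really decreases.\<close>
      have "mp.dim (derivs n ?Y) \<le> mp.dim (derivs n U)"
        using mp.subspace_dim_mono[OF subspace_derivs subspace_derivs derivs_mono[OF Y1]
            fin(2)[OF order_refl] finite_gens] .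
      moreover have "mp.dim ?Y \<le> Suc (mp.dim Y)"
        using mp.dim_span_insert_le[OF less.prems(1) fin(1)[OF less.prems(2)] finite_gens] .
      ultimately show ?thesis
        using less.hyps[of ?Y] d Y1 less.prems(3) by auto
    qed
  qed
  then show ?thesis using that by blast
qed

text \<open>The strict inequality supplies a square outside \<open>derivs n W\<close>, and the bound
  \<open>mp.dim W + 1\<close> is where the saved generator is spent.\<close>

lemma inverse_system_interpolation:
  fixes W :: "'k::field mpoly set"
  assumes W: "mp.subspace W" "W \<subseteq> forms n 3" "0 < mp.dim W"
    and b: "mp.dim (derivs n W) < b" "b \<le> mp.dim W + 1" "b \<le> mp.dim (forms n 2 :: 'k mpoly set)"
  obtains W' where "mp.subspace W'" "W' \<subseteq> forms n 3" "mp.dim W' = mp.dim W"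
    "mp.dim (derivs n W') = b" "derivs n W \<subseteq> derivs n W'"
proof -
  have D: "derivs n V \<subseteq> forms n 2" if "V \<subseteq> forms n 3" for V :: "'k mpoly set"
    using derivs_subset[of V n 2] that by (simp add: eval_nat_numeral)
  have fin: "V \<subseteq> mp.span (gens n 3)" if "V \<subseteq> forms n 3" for V :: "'k mpoly set"
    using that forms_subset_span by blast
  have "derivs n W \<noteq> forms n 2" using b by auto
  then obtain S where S: "S \<subseteq> {..<n}" "pow_form n 2 S \<notin> derivs n W"
    using ex_square_notin[OF subspace_derivs D[OF W(2)]] by blast
  let ?c = "pow_form n 3 S :: 'k mpoly"
  let ?W1 = "mp.span (insert ?c W)"
  have W1: "?W1 \<subseteq> forms n 3"
    using W(2) pow_form_in_forms by (intro mp.span_minimal subspace_forms) auto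
  have "mp.dim (derivs n ?W1) = Suc (mp.dim (derivs n W))"
    using mp.dim_span_insert[OF subspace_derivs _ finite_gens S(2), of n 2]
      D[OF W(2)] forms_subset_span derivs_insert_cube[OF S] by auto
  \<comment> \<open>The distinguished cube already uses one dimension, and the strict inequality
    leaves \<open>b\<close> at or above the new starting value.\<close>
  then obtain U where U: "mp.subspace U" "?W1 \<subseteq> U" "U \<subseteq> forms n 3" "mp.dim (derivs n U) = b"
    using enlarge_derivs[OF mp.subspace_span W1, of b] b by auto
  have WU: "W \<subseteq> U" using U(2) mp.span_superset[of "insert ?c W"] by blast
  have "W \<noteq> {0}" using W(3) mp.dim_le_card[of W "{}"] by auto
  then obtain G where G: "G \<in> W" "G \<noteq> 0" using mp.subspace_0[OF W(1)] by blast
  let ?F = "G + ?c"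
  have F: "?F \<in> U"
    using G(1) WU U(1,2) mp.span_superset[of "insert ?c W"] by (intro mp.subspace_add) auto
  have "mp.dim (mp.span {?F}) \<le> 1" using mp.dim_le_card[of "mp.span {?F}" "{?F}"] by simp
  moreover have "2 \<le> mp.dim (derivs n (mp.span {?F}))"
    unfolding derivs_span using derivs_add_cube_dim[OF W(1) G _ S] G(1) W(2) by auto
  moreover have "mp.span {?F} \<subseteq> U" using F U(1) by (intro mp.span_minimal) auto
  \<comment> \<open>Surplus 1: one generator with at least two independent contractions.\<close>
  ultimately obtain Y where Y: "mp.subspace Y" "Y \<subseteq> U" "derivs n Y = derivs n U"
    "mp.dim Y + 1 \<le> mp.dim (derivs n U)"
    using derivs_generators[OF U(1), of n 2 "mp.span {?F}" 1] U(3) by (auto simp: eval_nat_numeral)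
  \<comment> \<open>The surplus gives \<open>mp.dim Y + 1 \<le> b\<close>. Any space between
    \<open>Y\<close> and \<open>U\<close> has the derivatives of \<open>U\<close>, so its dimension
    can be adjusted to that of \<open>W\<close>.\<close>
  have "mp.dim Y \<le> mp.dim W" using Y(4) U(4) b by simp
  moreover have "mp.dim W \<le> mp.dim U"
    using mp.subspace_dim_mono[OF W(1) U(1) WU fin[OF U(3)] finite_gens] .
  ultimately obtain W' where W': "mp.subspace W'" "Y \<subseteq> W'" "W' \<subseteq> U" "mp.dim W' = mp.dim W"
    using mp.intermediate_subspace[OF Y(1) U(1) Y(2) fin[OF U(3)] finite_gens] by blast
  have "derivs n W' = derivs n U"
    using derivs_mono[OF W'(2), of n] derivs_mono[OF W'(3), of n] Y(3) by blast
  then show ?thesis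
    using that[OF W'(1) _ W'(4)] W'(3) U derivs_mono[OF WU, of n] by auto
qed

section \<open>Graded quotients and inverse systems\<close>

locale poly_ideal =
  fixes n :: nat and I :: "'k::field mpoly set"
  assumes is_ideal: "ideal I (poly_ring n)"
begin

sublocale idl: ideal I "poly_ring n"
  by (rule is_ideal)

sublocale quo: cring "quot_algebra n I"
  by (rule idl.quotient_is_cring[OF cring_poly_ring])

lemma quot_class_hom: "ring_hom_ring (poly_ring n) (quot_algebra n I) (quot_class n I)"
proof -
  have "quot_class n I = a_r_coset (poly_ring n) I" by (simp add: quot_class_def fun_eq_iff)
  then show ?thesis using idl.rcos_ring_hom_ring by simp
qed

sublocale qc: ring_hom_ring "poly_ring n" "quot_algebra n I" "quot_class n I"
  by (rule quot_class_hom)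

lemma I_mult: "q \<in> carrier (poly_ring n) \<Longrightarrow> p \<in> I \<Longrightarrow> q * p \<in> I"
  using idl.I_l_closed[of p q] by (simp add: poly_ring_simps)

lemma const_in_carrier: "Poly_Mapping.single 0 c \<in> carrier (poly_ring n)"
  by (simp add: poly_ring_simps)

lemma subspace_I: "mp.subspace I"
proof (rule mp.subspaceI)
  show "0 \<in> I" using additive_subgroup.zero_closed[OF idl.additive_subgroup_axioms] by (simp add: poly_ring_simps)
  show "x + y \<in> I" if "x \<in> I" "y \<in> I" for x y
    using additive_subgroup.a_closed[OF idl.additive_subgroup_axioms that] by (simp add: poly_ring_simps)
  show "scal c x \<in> I" if "x \<in> I" for c x
    unfolding scal_def using I_mult const_in_carrier that by blast
qed

lemma quot_class_eq_zero_iff: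
  assumes "p \<in> carrier (poly_ring n)"
  shows "quot_class n I p = \<zero>\<^bsub>quot_algebra n I\<^esub> \<longleftrightarrow> p \<in> I"
proof
  assume "p \<in> I"
  then show "quot_class n I p = \<zero>\<^bsub>quot_algebra n I\<^esub>"
    using idl.a_rcos_const by (simp add: quot_class_def FactRing_def)
next
  assume "quot_class n I p = \<zero>\<^bsub>quot_algebra n I\<^esub>"
  then have "I +>\<^bsub>poly_ring n\<^esub> p = I" by (simp add: quot_class_def FactRing_def)
  then show "p \<in> I" using idl.a_rcos_self[OF assms] by simp
qed

lemma quot_class_add:
  assumes "p \<in> carrier (poly_ring n)" "q \<in> carrier (poly_ring n)"
  shows "quot_class n I (p + q) = quot_class n I p \<oplus>\<^bsub>quot_algebra n I\<^esub> quot_class n I q"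
  using qc.hom_add[OF assms] by (simp add: poly_ring_simps)

lemma quot_class_mult:
  assumes "p \<in> carrier (poly_ring n)" "q \<in> carrier (poly_ring n)"
  shows "quot_class n I (p * q) = quot_class n I p \<otimes>\<^bsub>quot_algebra n I\<^esub> quot_class n I q"
  using qc.hom_mult[OF assms] by (simp add: poly_ring_simps)

lemma quot_class_scal:
  assumes "p \<in> carrier (poly_ring n)"
  shows "quot_class n I (scal c p)
    = quot_class n I (Poly_Mapping.single 0 c) \<otimes>\<^bsub>quot_algebra n I\<^esub> quot_class n I p"
  unfolding scal_def by (rule quot_class_mult[OF const_in_carrier assms])

lemma quot_class_eq_iff:
  assumes "p \<in> carrier (poly_ring n)" "q \<in> carrier (poly_ring n)"
  shows "quot_class n I p = quot_class n I q \<longleftrightarrow> p - q \<in> I"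
proof -
  have pq: "p - q \<in> carrier (poly_ring n)"
    using mp.subspace_diff[OF subspace_carrier] assms .
  have p: "quot_class n I p = quot_class n I (p - q) \<oplus>\<^bsub>quot_algebra n I\<^esub> quot_class n I q"
    using quot_class_add[OF pq assms(2)] by simp
  have "p - q \<in> I \<longleftrightarrow> quot_class n I (p - q) = \<zero>\<^bsub>quot_algebra n I\<^esub>"
    using quot_class_eq_zero_iff[OF pq] by simp
  also have "\<dots> \<longleftrightarrow> quot_class n I p = quot_class n I q"
    unfolding p using qc.hom_closed[OF pq] qc.hom_closed[OF assms(2)]
    by (metis quo.add.r_cancel_one' quo.l_zero)
  finally show ?thesis by simp
qed

lemma quot_carrier: "carrier (quot_algebra n I) = quot_class n I ` carrier (poly_ring n)"
  by (auto simp: FactRing_def A_RCOSETS_def' quot_class_def)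

text \<open>Uniqueness of \<open>ring.dimension\<close> is available over a subfield. Nonzero
  constants have constant inverses, and \<open>1 \<notin> I\<close> keeps one and zero
  apart.\<close>

lemma quot_scalars_subfield:
  assumes "1 \<notin> I"
  shows "subfield (quot_scalars n I) (quot_algebra n I)"
proof (rule quo.subfield_iff(1))
  let ?Q = "quot_algebra n I" and ?K = "quot_scalars n I"
  have one: "quot_class n I 1 = \<one>\<^bsub>?Q\<^esub>"
    using qc.hom_one by (simp add: poly_ring_simps)
  show sub: "?K \<subseteq> carrier ?Q"
    unfolding quot_scalars_def using const_in_carrier qc.hom_closed by blast
  have "subring ?K ?Q"
  proof (rule quo.subringI[OF sub])
    show "\<one>\<^bsub>?Q\<^esub> \<in> ?K"
      unfolding quot_scalars_def one[symmetric] single_one[symmetric] by blast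
    fix h assume "h \<in> ?K"
    then obtain c where h: "h = quot_class n I (Poly_Mapping.single 0 c)"
      unfolding quot_scalars_def by blast
    have "quot_class n I (Poly_Mapping.single 0 (- c)) \<oplus>\<^bsub>?Q\<^esub> h = \<zero>\<^bsub>?Q\<^esub>"
      unfolding h quot_class_add[OF const_in_carrier const_in_carrier, symmetric]
      using mp.subspace_0[OF subspace_I]
      by (simp add: quot_class_eq_zero_iff poly_ring_simps single_add[symmetric])
    then have "\<ominus>\<^bsub>?Q\<^esub> h = quot_class n I (Poly_Mapping.single 0 (- c))"
      using quo.minus_equality const_in_carrier qc.hom_closed h by blast
    then show "\<ominus>\<^bsub>?Q\<^esub> h \<in> ?K" unfolding quot_scalars_def by blast
    fix h' assume "h' \<in> ?K"
    then obtain c' where h': "h' = quot_class n I (Poly_Mapping.single 0 c')"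
      unfolding quot_scalars_def by blast
    show "h \<otimes>\<^bsub>?Q\<^esub> h' \<in> ?K"
      unfolding quot_scalars_def h h' quot_class_mult[OF const_in_carrier const_in_carrier, symmetric]
      by (simp add: mult_single)
    show "h \<oplus>\<^bsub>?Q\<^esub> h' \<in> ?K"
      unfolding quot_scalars_def h h' quot_class_add[OF const_in_carrier const_in_carrier, symmetric]
      by (simp add: single_add[symmetric])
  qed
  then have "cring (?Q\<lparr>carrier := ?K\<rparr>)"
    using quo.subcringI' quo.subcring_iff sub by blast
  then show "field (?Q\<lparr>carrier := ?K\<rparr>)"
  proof (rule cring.cring_fieldI2)
    have "\<one>\<^bsub>?Q\<^esub> \<noteq> \<zero>\<^bsub>?Q\<^esub>"
      using assms quot_class_eq_zero_iff[of 1] one poly_ring_consts(2) by metis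
    then show "\<zero>\<^bsub>?Q\<lparr>carrier := ?K\<rparr>\<^esub> \<noteq> \<one>\<^bsub>?Q\<lparr>carrier := ?K\<rparr>\<^esub>" by simp
    fix h assume h: "h \<in> carrier (?Q\<lparr>carrier := ?K\<rparr>)" "h \<noteq> \<zero>\<^bsub>?Q\<lparr>carrier := ?K\<rparr>\<^esub>"
    then obtain c where c: "h = quot_class n I (Poly_Mapping.single 0 c)"
      unfolding quot_scalars_def by auto
    have "c \<noteq> 0"
    proof
      assume "c = 0"
      then have "h = \<zero>\<^bsub>?Q\<^esub>" using c qc.hom_zero by (simp add: poly_ring_simps)
      then show False using h(2) by simp
    qed
    then have "h \<otimes>\<^bsub>?Q\<^esub> quot_class n I (Poly_Mapping.single 0 (inverse c)) = \<one>\<^bsub>?Q\<^esub>"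
      unfolding c quot_class_mult[OF const_in_carrier const_in_carrier, symmetric] one[symmetric]
      by (simp add: mult_single)
    then show "\<exists>b\<in>carrier (?Q\<lparr>carrier := ?K\<rparr>). h \<otimes>\<^bsub>?Q\<lparr>carrier := ?K\<rparr>\<^esub> b = \<one>\<^bsub>?Q\<lparr>carrier := ?K\<rparr>\<^esub>"
      unfolding quot_scalars_def by auto
  qed
qed

lemma has_dim_unique:
  assumes "1 \<notin> I" "has_dim n I V d" "has_dim n I V d'"
  shows "d = d'"
  using quo.dimension_is_inj[OF quot_scalars_subfield[OF assms(1)]] assms(2,3)
  unfolding has_dim_def by blast

text \<open>\<open>ring.dimension\<close> is built up by line extensions, so basis vectors are added
  one by one; the trivial intersection with \<open>I\<close> keeps each new class outside the span
  of the earlier ones.\<close>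

lemma has_dim_span_independent:
  assumes "finite B" "mp.independent B" "B \<subseteq> carrier (poly_ring n)" "mp.span B \<inter> I \<subseteq> {0}"
  shows "has_dim n I (quot_class n I ` mp.span B) (card B)"
  using assms
proof (induction B)
  case empty
  have "quot_class n I 0 = \<zero>\<^bsub>quot_algebra n I\<^esub>"
    using qc.hom_zero by (simp add: poly_ring_simps)
  then show ?case using quo.zero_dim by (simp add: has_dim_def)
next
  case (insert v B)
  let ?Q = "quot_algebra n I"
  have v: "v \<in> carrier (poly_ring n)" and "B \<subseteq> carrier (poly_ring n)" using insert.prems by auto
  then have B: "mp.span B \<subseteq> carrier (poly_ring n)"
    using mp.span_minimal subspace_carrier by blast
  have sub: "mp.span B \<subseteq> mp.span (insert v B)" by (intro mp.span_mono) auto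
  have indB: "mp.independent B" "v \<notin> mp.span B"
    using insert.prems(1) insert.hyps(2) by (auto simp: mp.independent_insert)
  have IH: "has_dim n I (quot_class n I ` mp.span B) (card B)"
    using insert.IH[OF indB(1)] insert.prems sub by blast
  have notin: "quot_class n I v \<notin> quot_class n I ` mp.span B"
  proof
    assume "quot_class n I v \<in> quot_class n I ` mp.span B"
    then obtain s where s: "s \<in> mp.span B" "quot_class n I v = quot_class n I s" by blast
    then have "v - s \<in> I" using quot_class_eq_iff[OF v] B by blast
    moreover have "v - s \<in> mp.span (insert v B)"
      using s(1) sub mp.span_base[of v "insert v B"] by (intro mp.span_diff) auto
    ultimately have "v = s" using insert.prems(3) by auto
    then show False using s(1) indB(2) by simp
  qed
  have "quot_class n I ` mp.span (insert v B)
      = quo.line_extension (quot_scalars n I) (quot_class n I v) (quot_class n I ` mp.span B)"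
    (is "?L = ?R")
  proof
    show "?L \<subseteq> ?R"
    proof
      fix u assume "u \<in> ?L"
      then obtain p k where p: "u = quot_class n I p" "p - scal k v \<in> mp.span B"
        by (auto simp: mp.span_insert)
      have "u = quot_class n I (scal k v + (p - scal k v))" using p(1) by simp
      also have "\<dots> = quot_class n I (Poly_Mapping.single 0 k) \<otimes>\<^bsub>?Q\<^esub> quot_class n I v
          \<oplus>\<^bsub>?Q\<^esub> quot_class n I (p - scal k v)"
        using quot_class_add quot_class_scal v p(2) B mp.subspace_scale[OF subspace_carrier]
        by (metis subset_iff)
      finally show "u \<in> ?R"
        unfolding quo.line_extension_mem_iff quot_scalars_def using p(2) by blast
    qed
    show "?R \<subseteq> ?L"
    proof
      fix u assume "u \<in> ?R"
      then obtain k s where s: "s \<in> mp.span B" and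
        "u = quot_class n I (Poly_Mapping.single 0 k) \<otimes>\<^bsub>?Q\<^esub> quot_class n I v \<oplus>\<^bsub>?Q\<^esub> quot_class n I s"
        unfolding quo.line_extension_mem_iff quot_scalars_def by blast
      then have "u = quot_class n I (scal k v + s)"
        using quot_class_add quot_class_scal v B mp.subspace_scale[OF subspace_carrier]
        by (metis subset_iff)
      moreover have "scal k v + s \<in> mp.span (insert v B)"
        using s sub mp.span_base[of v "insert v B"] by (intro mp.span_add mp.span_scale) auto
      ultimately show "u \<in> ?L" by blast
    qed
  qed
  then show ?case
    using quo.Suc_dim[OF qc.hom_closed[OF v] notin] IH insert.hyps by (simp add: has_dim_def)
qed

text \<open>Rank-nullity: a complement of \<open>V \<inter> I\<close> in \<open>V\<close> has the
  same image as \<open>V\<close> and meets \<open>I\<close> only in zero.\<close>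

lemma has_dim_quot_class:
  assumes V: "mp.subspace V" "V \<subseteq> carrier (poly_ring n)" "V \<subseteq> mp.span S" "finite S"
  shows "has_dim n I (quot_class n I ` V) (mp.dim V - mp.dim (V \<inter> I))"
proof -
  have VI: "mp.subspace (V \<inter> I)" using V(1) subspace_I by (rule mp.subspace_inter)
  obtain B where B: "finite B" "B \<subseteq> V" "mp.independent B" "mp.span B \<inter> (V \<inter> I) = {0}"
    "mp.span ((V \<inter> I) \<union> B) = V" "card B + mp.dim (V \<inter> I) = mp.dim V"
    using mp.subspace_complement[OF VI V(1) _ V(3,4)] by blast
  have sB: "mp.span B \<subseteq> V" using B(2) V(1) by (rule mp.span_minimal)
  have "quot_class n I ` V \<subseteq> quot_class n I ` mp.span B"
  proof
    fix u assume "u \<in> quot_class n I ` V"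
    then obtain v where v: "v \<in> V" "u = quot_class n I v" by blast
    then have "v \<in> mp.span ((V \<inter> I) \<union> B)" using B(5) by simp
    then obtain x y where xy: "x \<in> V \<inter> I" "y \<in> mp.span B" "v = x + y"
      unfolding mp.span_Un using mp.span_eq_iff[THEN iffD2, OF VI] by auto
    then have "v - y \<in> I" by simp
    then have "u = quot_class n I y"
      using quot_class_eq_iff[of v y] v V(2) xy(2) sB by blast
    then show "u \<in> quot_class n I ` mp.span B" using xy(2) by blast
  qed
  then have "quot_class n I ` V = quot_class n I ` mp.span B" using sB by blast
  moreover have "mp.span B \<inter> I \<subseteq> {0}" using B(4) sB by blast
  ultimately show ?thesis
    using has_dim_span_independent[OF B(1,3)] B(2,6) V(2) by (metis add_diff_cancel_right' order_trans)
qed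

lemma has_dim_graded_piece:
  "has_dim n I (graded_piece n I d) (mp.dim (forms n d :: 'k mpoly set) - mp.dim (forms n d \<inter> I))"
  unfolding graded_piece_def
  by (rule has_dim_quot_class[OF subspace_forms forms_subset_carrier forms_subset_span finite_gens])

end

section \<open>Multiplication by variables, and counts of monomials\<close>

lemma mult_vars_closed:
  fixes M :: "'k::field mpoly set"
  assumes M: "mp.subspace M" "\<And>i p. i < n \<Longrightarrow> p \<in> M \<Longrightarrow> var i * p \<in> M"
    and q: "q \<in> carrier (poly_ring n)" and p: "p \<in> M"
  shows "q * p \<in> M"
proof -
  have mon: "Poly_Mapping.single m 1 * p \<in> M" if "Poly_Mapping.keys m \<subseteq> {..<n}" for m
    using that
  proof (induction "mdeg m" arbitrary: m)
    case 0
    then show ?case using p by simp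
  next
    case (Suc d)
    then have "m \<noteq> 0" by auto
    then obtain i m' where i: "i \<in> Poly_Mapping.keys m" and m: "m = m' + unit_mono i"
      using monomial_cases by blast
    have eq: "Poly_Mapping.single m (1::'k) * p = var i * (Poly_Mapping.single m' 1 * p)"
      unfolding m by (simp add: mult_single mult.assoc[symmetric] add.commute)
    have "Poly_Mapping.single m' 1 * p \<in> M"
      using Suc m by (auto simp: keys_add_monomial)
    then have "var i * (Poly_Mapping.single m' 1 * p) \<in> M"
      using M(2) i Suc.prems by blast
    then show ?case unfolding eq .
  qed
  have "q * p = (\<Sum>m\<in>Poly_Mapping.keys q. scal (Poly_Mapping.lookup q m) (Poly_Mapping.single m 1 * p))"
    by (subst mpoly_eq_sum[of q]) (simp add: sum_distrib_right scal_def mult.assoc)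
  also have "\<dots> \<in> M"
    using q mon by (intro mp.subspace_sum M(1) mp.subspace_scale) (auto simp: poly_ring_def)
  finally show ?thesis .
qed

text \<open>Each monomial of \<open>q\<close> contains a variable, which is spent on
  \<open>p\<close>; the remaining factor preserves \<open>M\<close>. Hence the socle can be tested
  on the variables alone.\<close>

lemma mult_vars_mem:
  fixes M :: "'k::field mpoly set"
  assumes M: "mp.subspace M" "\<And>i p. i < n \<Longrightarrow> p \<in> M \<Longrightarrow> var i * p \<in> M"
    and q: "q \<in> carrier (poly_ring n)" "Poly_Mapping.lookup q 0 = 0"
    and p: "\<And>i. i < n \<Longrightarrow> var i * p \<in> M"
  shows "q * p \<in> M"
proof -
  have mon: "Poly_Mapping.single m 1 * p \<in> M"
    if m: "Poly_Mapping.keys m \<subseteq> {..<n}" "m \<noteq> 0" for m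
  proof -
    obtain i m' where i: "i \<in> Poly_Mapping.keys m" and m': "m = m' + unit_mono i"
      using monomial_cases m(2) by blast
    have eq: "Poly_Mapping.single m (1::'k) * p = Poly_Mapping.single m' 1 * (var i * p)"
      unfolding m' by (simp add: mult_single mult.assoc[symmetric])
    have "Poly_Mapping.single m' (1::'k) \<in> carrier (poly_ring n)"
      using m m' by (auto simp: poly_ring_def keys_add_monomial)
    then have "Poly_Mapping.single m' 1 * (var i * p) \<in> M"
      using mult_vars_closed[OF M] p i m(1) by blast
    then show ?thesis unfolding eq .
  qed
  have "Poly_Mapping.single m 1 * p \<in> M" if "m \<in> Poly_Mapping.keys q" for m
    using that q by (intro mon) (auto simp: poly_ring_def)
  then have "(\<Sum>m\<in>Poly_Mapping.keys q. scal (Poly_Mapping.lookup q m) (Poly_Mapping.single m 1 * p)) \<in> M"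
    by (intro mp.subspace_sum M(1) mp.subspace_scale)
  then show ?thesis
    by (subst mpoly_eq_sum[of q]) (simp add: sum_distrib_right scal_def mult.assoc)
qed

lemma var_in_carrier: "i < n \<Longrightarrow> var i \<in> carrier (poly_ring n)"
  by (simp add: poly_ring_def)

lemma dim_forms: "mp.dim (forms n d :: 'k::field mpoly set) = card (monoms n d)"
proof -
  have inj: "inj_on (\<lambda>m. Poly_Mapping.single m (1::'k)) (monoms n d)"
    by (rule inj_onI) (metis lookup_single_eq lookup_single_not_eq one_neq_zero)
  have "mp.independent (gens n d :: 'k mpoly set)"
  proof (rule mp.independent_if_scalars_zero[OF finite_gens])
    fix f :: "'k mpoly \<Rightarrow> 'k" and x :: "'k mpoly"
    assume s: "(\<Sum>x\<in>(gens n d :: 'k mpoly set). scal (f x) x) = 0" and "x \<in> gens n d"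
    then obtain m where m: "m \<in> monoms n d" "x = Poly_Mapping.single m 1" by (auto simp: gens_def)
    have "0 = Poly_Mapping.lookup (\<Sum>x\<in>(gens n d :: 'k mpoly set). scal (f x) x) m" using s by simp
    also have "\<dots> = (\<Sum>m'\<in>monoms n d. f (Poly_Mapping.single m' 1) * (1 when m' = m))"
      by (simp add: gens_def sum.reindex[OF inj] lookup_sum lookup_single)
    also have "\<dots> = f x"
      using m by (simp add: when_def if_distrib finite_monoms cong: if_cong)
    finally show "f x = 0" by simp
  qed
  moreover have "gens n d \<subseteq> (forms n d :: 'k mpoly set)"
    by (auto simp: gens_def forms_iff)
  ultimately have "card (gens n d :: 'k mpoly set) = mp.dim (forms n d :: 'k mpoly set)"
    using mp.basis_card_eq_dim forms_subset_span by blast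
  then show ?thesis by (simp add: gens_def card_image[OF inj])
qed

lemma monoms_0: "monoms n 0 = {0}"
  by (auto simp: monoms_def)

lemma card_monoms_1: "card (monoms n 1) = n"
proof -
  have "monoms n 1 = unit_mono ` {..<n}"
  proof
    show "monoms n 1 \<subseteq> unit_mono ` {..<n}"
    proof
      fix m assume m: "m \<in> monoms n 1"
      then have "m \<noteq> 0" by (auto simp: monoms_def)
      then obtain i m' where i: "i \<in> Poly_Mapping.keys m" and m': "m = m' + unit_mono i"
        using monomial_cases by blast
      have "mdeg m' = 0" using m m' by (simp add: monoms_def)
      then have "m = unit_mono i" using m' by simp
      then show "m \<in> unit_mono ` {..<n}" using i m by (auto simp: monoms_def)
    qed
  qed (auto simp: monoms_def)
  moreover have "inj_on unit_mono {..<n}"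
    by (rule inj_onI) (metis lookup_single_eq lookup_single_not_eq one_neq_zero)
  ultimately show ?thesis by (simp add: card_image)
qed

text \<open>A pair \<open>i \<le> j\<close> is recovered from the support of its monomial. This
  direction turns the binomial bound on \<open>b\<close> into a bound by the dimension of the
  quadrics.\<close>

lemma card_monoms_2: "(n + 1) choose 2 \<le> card (monoms n 2)"
proof -
  let ?P = "SIGMA j:{..<n}. {..j}"
  have "(n + 1) choose 2 = (\<Sum>j<n. Suc j)"
    by (induction n) (auto simp: numeral_2_eq_2)
  also have "\<dots> = card ?P" by simp
  also have "\<dots> \<le> card (monoms n 2)"
  proof (rule card_inj_on_le[OF _ _ finite_monoms])
    show "(\<lambda>(j, i). unit_mono i + unit_mono j) ` ?P \<subseteq> monoms n 2"
      by (auto simp: monoms_def keys_add_monomial)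
    show "inj_on (\<lambda>(j, i). unit_mono i + unit_mono j) ?P"
    proof (rule inj_onI, clarify)
      fix j i j' i' assume le: "i \<le> j" "i' \<le> j'" and eq: "unit_mono i + unit_mono j = unit_mono i' + unit_mono j'"
      have "{i, j} = {i', j'}"
        using arg_cong[OF eq, of Poly_Mapping.keys] by (auto simp: keys_add_monomial insert_commute)
      then show "j = j' \<and> i = i'" using le by (auto simp: doubleton_eq_iff)
    qed
  qed
  finally show ?thesis .
qed

lemma pair_hom_component:
  assumes "f \<in> forms n d"
  shows "pair f (hom_component e p) = (if d = e then pair f p else 0)"
  using assms unfolding pair_def by (auto simp: forms_def intro!: sum.cong sum.neutral)

lemma pair_forms_ne: "f \<in> forms n d \<Longrightarrow> p \<in> forms n e \<Longrightarrow> d \<noteq> e \<Longrightarrow> pair f p = 0"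
  using pair_hom_component[of f n d e p] hom_component_form[of p n e e] by simp

lemma var_forms:
  assumes "i < n" "p \<in> forms n d"
  shows "var i * p \<in> forms n (Suc d)"
proof -
  have "m + unit_mono i \<in> monoms n (Suc d)" if "m \<in> monoms n d" for m
    using that assms(1) by (simp add: monoms_def keys_add_monomial)
  then show ?thesis using assms(2) by (auto simp: forms_iff keys_shift)
qed

section \<open>From a level algebra to its inverse system\<close>

context poly_ideal
begin

abbreviation inverse_system :: "nat \<Rightarrow> 'k mpoly set" where
  "inverse_system d \<equiv> ann n d (forms n d \<inter> I)"

lemma subspace_forms_I: "mp.subspace (forms n d \<inter> I)"
  using subspace_forms subspace_I by (rule mp.subspace_inter)

lemma has_dim_graded_piece_ann:
  "has_dim n I (graded_piece n I d) (mp.dim (inverse_system d))"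
  using has_dim_graded_piece[of d] dim_ann[OF subspace_forms_I Int_lower1, of d]
  by (metis add_diff_cancel_right')

text \<open>By adjointness the annihilator of the contractions consists of the forms
  \<open>p\<close> with every \<open>var i * p\<close> in \<open>I\<close>. The assumption excludes
  socle in degree \<open>d\<close>, so these are the forms in \<open>I\<close>, and
  \<open>ann_ann\<close> concludes.\<close>

lemma derivs_inverse_system:
  assumes "\<And>p. p \<in> forms n d \<Longrightarrow> (\<And>i. i < n \<Longrightarrow> var i * p \<in> I) \<Longrightarrow> p \<in> I"
  shows "derivs n (inverse_system (Suc d)) = inverse_system d"
proof -
  let ?E = "derivs n (inverse_system (Suc d))"
  have E: "?E \<subseteq> forms n d" by (rule derivs_subset[OF ann_subset_forms])
  have "ann n d ?E = forms n d \<inter> I"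
  proof
    show "ann n d ?E \<subseteq> forms n d \<inter> I"
    proof
      fix p assume p: "p \<in> ann n d ?E"
      then have pf: "p \<in> forms n d" by (simp add: ann_def)
      have "var i * p \<in> I" if i: "i < n" for i
      proof -
        have "pair (con i f) p = 0" if "f \<in> inverse_system (Suc d)" for f
          using p con_in_derivs[OF that i] unfolding ann_def by blast
        then have "pair f (var i * p) = 0" if "f \<in> inverse_system (Suc d)" for f
          using that unfolding pair_con by blast
        then have "var i * p \<in> ann n (Suc d) (inverse_system (Suc d))"
          using var_forms[OF i pf] by (simp add: ann_def)
        then show ?thesis using ann_ann[OF subspace_forms_I Int_lower1, of "Suc d"] by simp
      qed
      then show "p \<in> forms n d \<inter> I" using assms pf by blast
    qed
    show "forms n d \<inter> I \<subseteq> ann n d ?E"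
    proof
      fix p assume p: "p \<in> forms n d \<inter> I"
      have "pair f p = 0" if f: "f \<in> (\<Union>i<n. con i ` inverse_system (Suc d))" for f
      proof -
        obtain i g where i: "i < n" and g: "g \<in> inverse_system (Suc d)" and fg: "f = con i g"
          using f by blast
        have "var i * p \<in> forms n (Suc d) \<inter> I"
          using p var_forms[OF i] I_mult[OF var_in_carrier[OF i]] by blast
        then have "pair (var i * p) g = 0" using g by (simp add: ann_def)
        then show ?thesis unfolding fg pair_con by (subst pair_commute)
      qed
      then have "p \<in> ann n d (\<Union>i<n. con i ` inverse_system (Suc d))"
        using p unfolding ann_def by blast
      then show "p \<in> ann n d ?E" unfolding derivs_def ann_span .
    qed
  qed
  then show ?thesis
    using ann_ann[OF subspace_derivs E] by simp
qed

text \<open>Such a \<open>p\<close> represents a socle element, hence is congruent to a form of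
  degree \<open>e\<close>. Homogeneity puts the degree \<open>d\<close> component of the difference
  into \<open>I\<close>, and that component is \<open>p\<close>.\<close>

lemma level_quotient:
  assumes hom: "homogeneous_ideal n I" and lev: "quot_socle n I \<subseteq> graded_piece n I e"
    and p: "p \<in> forms n d" "d \<noteq> e" and vars: "\<And>i. i < n \<Longrightarrow> var i * p \<in> I"
  shows "p \<in> I"
proof -
  have pc: "p \<in> carrier (poly_ring n)" using p(1) forms_subset_carrier by blast
  have "quot_class n I p \<in> quot_socle n I"
    unfolding quot_socle_def
  proof (intro CollectI conjI ballI)
    show "quot_class n I p \<in> carrier (quot_algebra n I)" using qc.hom_closed[OF pc] .
    fix x assume "x \<in> quot_max_ideal n I"
    then obtain q where q: "q \<in> carrier (poly_ring n)" "Poly_Mapping.lookup q 0 = 0"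
      and x: "x = quot_class n I q"
      unfolding quot_max_ideal_def by blast
    have "q * p \<in> I"
      by (rule mult_vars_mem[OF subspace_I _ q vars]) (use I_mult var_in_carrier in blast)+
    then show "x \<otimes>\<^bsub>quot_algebra n I\<^esub> quot_class n I p = \<zero>\<^bsub>quot_algebra n I\<^esub>"
      unfolding x quot_class_mult[OF q(1) pc, symmetric]
      using quot_class_eq_zero_iff poly_ring_closed(2)[OF q(1) pc] by blast
  qed
  then obtain f where f: "f \<in> forms n e" "quot_class n I p = quot_class n I f"
    using lev unfolding graded_piece_def by blast
  then have "p - f \<in> I"
    using quot_class_eq_iff[OF pc] forms_subset_carrier by blast
  then have "hom_component d (p - f) \<in> I"
    using hom unfolding homogeneous_ideal_def by blast
  then show ?thesis
    using p f(1) by (simp add: hom_component_diff hom_component_form)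
qed

end

text \<open>\<open>W\<close> is the degree 3 part of the inverse system. Levelness produces degrees
  2 and 1 from it by contraction, and since \<open>I\<close> has no nonzero linear form, degree 1 is
  the whole space, whence also \<open>r = n\<close>.\<close>

lemma level_inverse_system:
  fixes I :: "'k::field mpoly set"
  assumes A: "standard_graded_artinian n I" and h: "is_h_vector n I [1, r, a, t]"
    and lev: "level_algebra n I 3 t"
  obtains W where "r = n" "mp.subspace W" "W \<subseteq> forms n 3" "mp.dim W = t" "0 < t"
    "mp.dim (derivs n W) = a" "derivs n (derivs n W) = (forms n 1 :: 'k mpoly set)"
proof -
  have hom: "homogeneous_ideal n I" and I1: "\<And>p. p \<in> I \<Longrightarrow> p \<in> forms n 1 \<Longrightarrow> p = 0"
    using A unfolding standard_graded_artinian_def by blast+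
  interpret poly_ideal n I
    by (rule poly_ideal.intro) (use hom in \<open>simp add: homogeneous_ideal_def\<close>)
  have dims: "has_dim n I (graded_piece n I i) ([1, r, a, t] ! i)" if "i < 4" for i
    using h that by (simp add: is_h_vector_def)
  have t: "0 < t" using h by (simp add: is_h_vector_def)
  \<comment> \<open>Needed for uniqueness of dimensions: a zero quotient would contradict the
    leading entry 1 of the h-vector.\<close>
  have "1 \<notin> I"
  proof
    assume one: "1 \<in> I"
    have "quot_class n I p = \<zero>\<^bsub>quot_algebra n I\<^esub>" if "p \<in> carrier (poly_ring n)" for p
      using I_mult[OF that one] quot_class_eq_zero_iff[OF that] by simp
    then have "carrier (quot_algebra n I) \<subseteq> {\<zero>\<^bsub>quot_algebra n I\<^esub>}"
      unfolding quot_carrier by blast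
    moreover have "quo.dimension (Suc 0) (quot_scalars n I) (graded_piece n I 0)"
      using dims[of 0] by (simp add: has_dim_def)
    then obtain v E where "v \<in> carrier (quot_algebra n I)" "v \<notin> E"
      "quo.dimension 0 (quot_scalars n I) E"
      by (cases rule: quo.dimension.cases) auto
    moreover have "E = {\<zero>\<^bsub>quot_algebra n I\<^esub>}"
      using \<open>quo.dimension 0 (quot_scalars n I) E\<close> by (cases rule: quo.dimension.cases) auto
    ultimately show False by blast
  qed
  then have dim: "[1, r, a, t] ! i = mp.dim (inverse_system i)" if "i < 4" for i
    using has_dim_unique[OF _ dims[OF that] has_dim_graded_piece_ann] by blast
  have lq: "p \<in> I" if "p \<in> forms n d" "d \<noteq> 3" "\<And>i. i < n \<Longrightarrow> var i * p \<in> I" for p d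
    using level_quotient[OF hom _ that] lev by (simp add: level_algebra_def)
  have D2: "derivs n (inverse_system 3) = inverse_system 2"
    using derivs_inverse_system[of 2] lq[of _ 2] by (simp add: eval_nat_numeral)
  have D1: "derivs n (inverse_system 2) = inverse_system 1"
    using derivs_inverse_system[of 1] lq[of _ 1] by (simp add: eval_nat_numeral)
  have "0 \<in> forms n 1 \<inter> I" using mp.subspace_0[OF subspace_forms_I] .
  then have "forms n 1 \<inter> I = {0}" using I1 by blast
  then have I1': "inverse_system 1 = forms n 1" by (simp add: ann_def)
  show ?thesis
  proof (rule that[of "inverse_system 3"])
    show "r = n" using dim[of 1] unfolding I1' dim_forms card_monoms_1 by simp
    show "mp.dim (inverse_system 3) = t" "mp.dim (derivs n (inverse_system 3)) = a"
      using dim[of 3] dim[of 2] D2 by simp_all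
    show "derivs n (derivs n (inverse_system 3)) = forms n 1"
      unfolding D2 D1 I1' ..
  qed (rule t subspace_ann ann_subset_forms)+
qed

section \<open>From a space of cubics back to a level algebra\<close>

locale level_system =
  fixes n :: nat and W :: "'k::field mpoly set"
  assumes W: "mp.subspace W" "W \<subseteq> forms n 3" "0 < mp.dim W"
    and full: "derivs n (derivs n W) = forms n 1"
begin

text \<open>Degrees below 2 are set to all forms outright; by \<open>full\<close> and
  \<open>derivs_forms_1\<close> this agrees with contracting down from \<open>W\<close>. Zero above
  degree 3 puts all higher forms into the ideal.\<close>

definition inv_sys :: "nat \<Rightarrow> 'k mpoly set" where
  "inv_sys d = (if d = 3 then W else if d = 2 then derivs n W
     else if d < 2 then forms n d else {0})"

definition inv_ideal :: "'k mpoly set" where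
  "inv_ideal = {p \<in> carrier (poly_ring n). \<forall>d. \<forall>f\<in>inv_sys d. pair f p = 0}"

lemma inv_ideal_I: "p \<in> carrier (poly_ring n) \<Longrightarrow> (\<And>f d. f \<in> inv_sys d \<Longrightarrow> pair f p = 0) \<Longrightarrow> p \<in> inv_ideal"
  unfolding inv_ideal_def by blast

lemma inv_ideal_carrier: "p \<in> inv_ideal \<Longrightarrow> p \<in> carrier (poly_ring n)"
  unfolding inv_ideal_def by blast

lemma inv_ideal_pair: "p \<in> inv_ideal \<Longrightarrow> f \<in> inv_sys d \<Longrightarrow> pair f p = 0"
  unfolding inv_ideal_def by blast

lemma derivs_subset_forms: "derivs n W \<subseteq> forms n 2"
  using derivs_subset[of W n 2] W(2) by (simp add: eval_nat_numeral)

lemma inv_sys_subset: "inv_sys d \<subseteq> forms n d"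
  using W(2) derivs_subset_forms mp.subspace_0[OF subspace_forms] by (auto simp: inv_sys_def)

lemma subspace_inv_sys: "mp.subspace (inv_sys d)"
  using W(1) by (simp add: inv_sys_def subspace_derivs subspace_forms mp.subspace_single_0)

lemma n_pos: "0 < n"
proof (rule ccontr)
  assume "\<not> 0 < n"
  then have "monoms n 3 = {}" by (auto simp: monoms_def)
  then have "W \<subseteq> {0}" using W(2) by (auto simp: forms_eq)
  then show False using W(3) mp.dim_le_card[of W "{}"] by auto
qed

lemma derivs_forms_1: "derivs n (forms n 1) = (forms n 0 :: 'k mpoly set)"
proof
  show "derivs n (forms n 1) \<subseteq> (forms n 0 :: 'k mpoly set)"
    using derivs_subset[of "forms n 1" n 0] by simp
  have "con 0 (pow_form n 1 {0}) = (pow_form n 0 {0} :: 'k mpoly)"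
    using con_pow_form[OF n_pos, of 0 "{0}"] by simp
  also have "\<dots> = Poly_Mapping.single 0 1"
    by (rule poly_mapping_eqI) (auto simp: lookup_pow_form monoms_0 lookup_one when_def)
  finally have "Poly_Mapping.single 0 1 \<in> derivs n (forms n 1 :: 'k mpoly set)"
    using con_in_derivs[OF pow_form_in_forms n_pos] by metis
  then have "mp.span (gens n 0) \<subseteq> derivs n (forms n 1 :: 'k mpoly set)"
    by (intro mp.span_minimal subspace_derivs) (simp add: gens_def monoms_0)
  then show "forms n 0 \<subseteq> derivs n (forms n 1 :: 'k mpoly set)"
    using forms_subset_span by blast
qed

lemma inv_sys_derivs: "d < 3 \<Longrightarrow> inv_sys d = derivs n (inv_sys (Suc d))"
proof -
  assume "d < 3"
  then consider "d = 0" | "d = 1" | "d = 2" by linarith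
  then show ?thesis
    using derivs_forms_1 full by cases (simp_all add: inv_sys_def eval_nat_numeral)
qed

text \<open>The degree stays existential because an element of degree 0 contracts to zero, which
  lies in every piece.\<close>

lemma con_inv_sys:
  assumes "f \<in> inv_sys d" "i < n"
  shows "\<exists>e. con i f \<in> inv_sys e"
proof (cases d)
  case 0
  then have "con i f = 0" using assms(1) inv_sys_subset con_in_forms_0 by blast
  then show ?thesis using mp.subspace_0[OF subspace_inv_sys] by metis
next
  case (Suc e)
  show ?thesis
  proof (cases "e < 3")
    case True
    then show ?thesis using inv_sys_derivs con_in_derivs assms Suc by metis
  next
    case False
    then have "f = 0" using assms(1) Suc by (simp add: inv_sys_def)
    then show ?thesis using mp.subspace_0[OF subspace_inv_sys] by (metis con_0)
  qed
qed

lemma subspace_inv_ideal: "mp.subspace inv_ideal"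
proof (rule mp.subspaceI)
  show "0 \<in> inv_ideal" by (simp add: inv_ideal_def poly_ring_consts)
  show "x + y \<in> inv_ideal" if "x \<in> inv_ideal" "y \<in> inv_ideal" for x y
    using that by (simp add: inv_ideal_def pair_add_right poly_ring_closed(1))
  show "scal c x \<in> inv_ideal" if "x \<in> inv_ideal" for c x
    using that by (simp add: inv_ideal_def pair_scal_right mp.subspace_scale[OF subspace_carrier])
qed

text \<open>Adjoint to the closure of the system under contraction.\<close>

lemma var_mult_inv_ideal:
  assumes "i < n" "p \<in> inv_ideal"
  shows "var i * p \<in> inv_ideal"
proof -
  have "pair f (var i * p) = 0" if "f \<in> inv_sys d" for f d
    unfolding pair_con[symmetric] using con_inv_sys[OF that assms(1)] inv_ideal_pair[OF assms(2)] by blast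
  then show ?thesis
    by (rule inv_ideal_I[OF poly_ring_closed(2)[OF var_in_carrier[OF assms(1)] inv_ideal_carrier[OF assms(2)]]])
qed

lemma ideal_inv_ideal: "ideal inv_ideal (poly_ring n)"
proof -
  interpret R: cring "poly_ring n" by (rule cring_poly_ring)
  have sub: "inv_ideal \<subseteq> carrier (poly_ring n)" using inv_ideal_carrier by blast
  have mult: "x * a \<in> inv_ideal" if "a \<in> inv_ideal" "x \<in> carrier (poly_ring n)" for a x
    using mult_vars_closed[OF subspace_inv_ideal var_mult_inv_ideal that(2,1)] by blast
  show ?thesis
  proof (rule idealI[OF R.ring_axioms])
    show "subgroup inv_ideal (add_monoid (poly_ring n))"
    proof (rule R.add.subgroupI)
      show "inv_ideal \<subseteq> carrier (poly_ring n)" by (rule sub)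
      show "inv_ideal \<noteq> {}" using mp.subspace_0[OF subspace_inv_ideal] by blast
      fix x assume x: "x \<in> inv_ideal"
      have "- x \<oplus>\<^bsub>poly_ring n\<^esub> x = \<zero>\<^bsub>poly_ring n\<^esub>" by (simp add: poly_ring_simps)
      then have "\<ominus>\<^bsub>poly_ring n\<^esub> x = - x"
        using R.minus_equality x sub poly_ring_closed(3) by blast
      then show "\<ominus>\<^bsub>poly_ring n\<^esub> x \<in> inv_ideal" using mp.subspace_neg[OF subspace_inv_ideal x] by simp
      show "x \<oplus>\<^bsub>poly_ring n\<^esub> y \<in> inv_ideal" if "y \<in> inv_ideal" for y
        using mp.subspace_add[OF subspace_inv_ideal x that] by (simp add: poly_ring_simps)
    qed
  qed (use mult in \<open>simp_all add: poly_ring_simps mult.commute\<close>)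
qed

sublocale poly_ideal n inv_ideal
  by (rule poly_ideal.intro) (rule ideal_inv_ideal)

lemma homogeneous_inv_ideal: "homogeneous_ideal n inv_ideal"
  unfolding homogeneous_ideal_def
proof (intro conjI ballI allI ideal_inv_ideal)
  fix p d assume p: "p \<in> inv_ideal"
  show "hom_component d p \<in> inv_ideal"
  proof (rule inv_ideal_I)
    show "hom_component d p \<in> carrier (poly_ring n)"
      using hom_component_in_forms[OF inv_ideal_carrier[OF p]] forms_subset_carrier by blast
    show "pair f (hom_component d p) = 0" if "f \<in> inv_sys e" for f e
      using pair_hom_component[OF subsetD[OF inv_sys_subset that]] inv_ideal_pair[OF p that] by simp
  qed
qed

lemma forms_inv_ideal: "forms n d \<inter> inv_ideal = ann n d (inv_sys d)"
proof
  show "forms n d \<inter> inv_ideal \<subseteq> ann n d (inv_sys d)"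
    using inv_ideal_pair unfolding ann_def by blast
  show "ann n d (inv_sys d) \<subseteq> forms n d \<inter> inv_ideal"
  proof
    fix p assume p: "p \<in> ann n d (inv_sys d)"
    then have pf: "p \<in> forms n d" by (simp add: ann_def)
    have "pair f p = 0" if f: "f \<in> inv_sys e" for f e
    proof (cases "e = d")
      case True
      then show ?thesis using p f by (simp add: ann_def)
    next
      case False
      then show ?thesis by (rule pair_forms_ne[OF subsetD[OF inv_sys_subset f] pf])
    qed
    then show "p \<in> forms n d \<inter> inv_ideal"
      using inv_ideal_I[of p] pf forms_subset_carrier by blast
  qed
qed

lemma has_dim_inv_sys: "has_dim n inv_ideal (graded_piece n inv_ideal d) (mp.dim (inv_sys d))"
  using has_dim_graded_piece_ann[of d] unfolding forms_inv_ideal ann_ann[OF subspace_inv_sys inv_sys_subset] .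

text \<open>The system has nothing above degree 3, so the pairings see only the components up to
  that degree.\<close>

lemma diff_truncation:
  assumes p: "p \<in> carrier (poly_ring n)"
  shows "p - (\<Sum>d\<le>3. hom_component d p) \<in> inv_ideal"
proof -
  have "hom_component d p \<in> carrier (poly_ring n)" for d
    using hom_component_in_forms[OF p] forms_subset_carrier by blast
  then have "p - (\<Sum>d\<le>3. hom_component d p) \<in> carrier (poly_ring n)"
    by (intro mp.subspace_diff mp.subspace_sum subspace_carrier p)
  moreover have "pair f (p - (\<Sum>d\<le>3. hom_component d p)) = 0" if f: "f \<in> inv_sys e" for f e
  proof (cases "e \<le> 3")
    case True
    have "pair f (\<Sum>d\<in>A. hom_component d p) = (\<Sum>d\<in>A. if e = d then pair f p else 0)"
      if "finite A" for A
      using that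
      by (induction A) (simp_all add: pair_add_right pair_hom_component[OF subsetD[OF inv_sys_subset f]])
    then show ?thesis using True by (simp add: pair_diff_right)
  next
    case False
    then show ?thesis using f by (simp add: inv_sys_def)
  qed
  ultimately show ?thesis by (rule inv_ideal_I)
qed

text \<open>Truncation makes every class come from the finite-dimensional space \<open>T\<close>. A
  descending chain of ideals thus pulls back to a descending chain of subspaces of \<open>T\<close>
  and is recovered from it.\<close>

lemma artinian_inv_ideal: "artinian_ring (quot_algebra n inv_ideal)"
proof (intro artinian_ring.intro artinian_ring_axioms.intro quo.ring_axioms)
  fix K :: "nat \<Rightarrow> 'k mpoly set set"
  let ?Q = "quot_algebra n inv_ideal"
  assume K: "\<And>i. ideal (K i) ?Q" and dec: "\<And>i. K (Suc i) \<subseteq> K i"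
  define M where "M = (\<Union>d\<le>3. monoms n d)"
  define T :: "'k mpoly set" where "T = {p. Poly_Mapping.keys p \<subseteq> M}"
  define Z :: "'k mpoly set" where "Z = (\<lambda>m. Poly_Mapping.single m 1) ` M"
  define L where "L i = {p \<in> T. quot_class n inv_ideal p \<in> K i}" for i
  have finZ: "finite Z" by (simp add: Z_def M_def finite_monoms)
  have T: "mp.subspace T" "T \<subseteq> mp.span Z" "T \<subseteq> carrier (poly_ring n)"
    unfolding T_def Z_def using subspace_keys keys_subset_span
    by (auto simp: M_def monoms_def poly_ring_def)
  have L: "mp.subspace (L i)" for i
  proof (rule mp.subspaceI)
    interpret Ki: ideal "K i" ?Q by (rule K)
    note Ka = Ki.additive_subgroup_axioms
    have "quot_class n inv_ideal 0 = \<zero>\<^bsub>?Q\<^esub>" using qc.hom_zero by (simp add: poly_ring_simps)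
    then show "0 \<in> L i"
      using additive_subgroup.zero_closed[OF Ka] mp.subspace_0[OF T(1)] by (simp add: L_def)
    show "x + y \<in> L i" if "x \<in> L i" "y \<in> L i" for x y
      using that additive_subgroup.a_closed[OF Ka] mp.subspace_add[OF T(1)] quot_class_add T(3)
      by (auto simp: L_def subset_iff)
    show "scal c x \<in> L i" if "x \<in> L i" for c x
      using that Ki.I_l_closed mp.subspace_scale[OF T(1)] quot_class_scal T(3)
        qc.hom_closed[OF const_in_carrier]
      by (auto simp: L_def subset_iff)
  qed
  have Ls: "L i \<subseteq> mp.span Z" for i using T(2) by (auto simp: L_def)
  have KL: "K i = quot_class n inv_ideal ` L i" for i
  proof
    show "K i \<subseteq> quot_class n inv_ideal ` L i"
    proof
      fix x assume x: "x \<in> K i"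
      then have "x \<in> carrier ?Q"
        using additive_subgroup.a_subset[OF ideal.axioms(1)[OF K]] by blast
      then obtain p where p: "p \<in> carrier (poly_ring n)" "x = quot_class n inv_ideal p"
        unfolding quot_carrier by blast
      let ?p = "\<Sum>d\<le>3. hom_component d p"
      have "hom_component d p \<in> T" if "d \<le> 3" for d
        using hom_component_in_forms[OF p(1), of d] that by (auto simp: T_def M_def forms_iff)
      then have pT: "?p \<in> T" by (intro mp.subspace_sum T(1)) simp
      then have "x = quot_class n inv_ideal ?p"
        using quot_class_eq_iff[OF p(1), of ?p] diff_truncation[OF p(1)] T(3) p(2) by blast
      then show "x \<in> quot_class n inv_ideal ` L i" using pT x by (auto simp: L_def)
    qed
  qed (auto simp: L_def)
  have anti: "L j \<subseteq> L i" if "i \<le> j" for i j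
    using lift_Suc_antimono_le[of K, OF dec that] by (auto simp: L_def)
  \<comment> \<open>At an index of least dimension the chain of subspaces must stop.\<close>
  obtain N where N: "\<And>i. mp.dim (L N) \<le> mp.dim (L i)"
    using ex_has_least_nat[of "\<lambda>_. True" 0 "\<lambda>i. mp.dim (L i)"] by blast
  have "L i = L N" if "N \<le> i" for i
    by (rule mp.subspace_eqI_dim[OF L L anti[OF that] Ls finZ N])
  then show "\<exists>N. \<forall>i\<ge>N. K i = K N" unfolding KL by metis
qed

text \<open>If the variables kill the class of \<open>p\<close>, then \<open>p\<close> is orthogonal
  to all contractions, hence to the system below degree 3, and only its cubic component
  survives.\<close>

lemma socle_inv_ideal: "quot_socle n inv_ideal = graded_piece n inv_ideal 3"
proof
  let ?Q = "quot_algebra n inv_ideal"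
  show "quot_socle n inv_ideal \<subseteq> graded_piece n inv_ideal 3"
  proof
    fix x assume x: "x \<in> quot_socle n inv_ideal"
    then obtain p where p: "p \<in> carrier (poly_ring n)" "x = quot_class n inv_ideal p"
      unfolding quot_socle_def quot_carrier by blast
    have var: "var i * p \<in> inv_ideal" if i: "i < n" for i
    proof -
      have "Poly_Mapping.lookup (var i :: 'k mpoly) 0 = 0"
        by (metis lookup_single_not_eq mdeg_0 mdeg_single zero_neq_one)
      then have "quot_class n inv_ideal (var i) \<in> quot_max_ideal n inv_ideal"
        unfolding quot_max_ideal_def using var_in_carrier[OF i] by blast
      then have "quot_class n inv_ideal (var i * p) = \<zero>\<^bsub>?Q\<^esub>"
        using x quot_class_mult[OF var_in_carrier[OF i] p(1)] unfolding quot_socle_def p(2) by auto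
      then show ?thesis
        using quot_class_eq_zero_iff poly_ring_closed(2)[OF var_in_carrier[OF i] p(1)] by blast
    qed
    have f: "hom_component 3 p \<in> forms n 3" using hom_component_in_forms[OF p(1)] .
    have "pair f (p - hom_component 3 p) = 0" if "f \<in> inv_sys e" for f e
    proof (cases "e = 3")
      case True
      then show ?thesis
        using pair_hom_component[OF subsetD[OF inv_sys_subset that], of 3 p] by (simp add: pair_diff_right)
    next
      case False
      then have "pair f (hom_component 3 p) = 0"
        using pair_hom_component[OF subsetD[OF inv_sys_subset that], of 3 p] by simp
      \<comment> \<open>Below degree 3 \<open>f\<close> is a combination of contractions, so the
        pairing moves a variable onto \<open>p\<close>; above degree 3 \<open>f\<close> is
        zero.\<close>
      moreover have "pair f p = 0"
      proof (cases "e < 3")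
        case True
        have "pair (con i g) p = 0" if "i < n" "g \<in> inv_sys (Suc e)" for i g
          unfolding pair_con using inv_ideal_pair[OF var[OF that(1)] that(2)] .
        then have "\<forall>g\<in>(\<Union>i<n. con i ` inv_sys (Suc e)). pair g p = 0" by blast
        moreover have "f \<in> mp.span (\<Union>i<n. con i ` inv_sys (Suc e))"
          using \<open>f \<in> inv_sys e\<close> inv_sys_derivs[OF True] unfolding derivs_def by simp
        ultimately show ?thesis by (rule pair_span_eq_0)
      next
        case False
        then have "f = 0" using that \<open>e \<noteq> 3\<close> by (simp add: inv_sys_def)
        then show ?thesis by simp
      qed
      ultimately show ?thesis by (simp add: pair_diff_right)
    qed
    moreover have "p - hom_component 3 p \<in> carrier (poly_ring n)"
      using mp.subspace_diff[OF subspace_carrier p(1)] f forms_subset_carrier by blast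
    ultimately have "p - hom_component 3 p \<in> inv_ideal" by (intro inv_ideal_I)
    then have "x = quot_class n inv_ideal (hom_component 3 p)"
      using quot_class_eq_iff[OF p(1)] f forms_subset_carrier p(2) by blast
    then show "x \<in> graded_piece n inv_ideal 3" unfolding graded_piece_def using f by blast
  qed
  show "graded_piece n inv_ideal 3 \<subseteq> quot_socle n inv_ideal"
  proof
    fix x assume "x \<in> graded_piece n inv_ideal 3"
    then obtain p where p: "p \<in> forms n 3" "x = quot_class n inv_ideal p"
      unfolding graded_piece_def by blast
    have pc: "p \<in> carrier (poly_ring n)" using p(1) forms_subset_carrier by blast
    have "var i * p \<in> inv_ideal" if i: "i < n" for i
    proof -
      \<comment> \<open>The system vanishes in degree 4, so every quartic form lies in the
        ideal.\<close>
      have "var i * p \<in> forms n 4"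
        using var_forms[OF i p(1)] by (simp add: eval_nat_numeral)
      then have "var i * p \<in> ann n 4 (inv_sys 4)" by (simp add: ann_def inv_sys_def)
      then show ?thesis using forms_inv_ideal by blast
    qed
    then have "q * p \<in> inv_ideal" if "q \<in> carrier (poly_ring n)" "Poly_Mapping.lookup q 0 = 0" for q
      using mult_vars_mem[OF subspace_inv_ideal var_mult_inv_ideal that] by blast
    then have "quot_class n inv_ideal q \<otimes>\<^bsub>?Q\<^esub> x = \<zero>\<^bsub>?Q\<^esub>"
      if "q \<in> carrier (poly_ring n)" "Poly_Mapping.lookup q 0 = 0" for q
      using that quot_class_mult[OF that(1) pc] quot_class_eq_zero_iff[OF poly_ring_closed(2)[OF that(1) pc]]
      unfolding p(2) by auto
    then show "x \<in> quot_socle n inv_ideal"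
      unfolding quot_socle_def quot_max_ideal_def using qc.hom_closed[OF pc] p(2) by auto
  qed
qed

lemma level_h_vector_inv_ideal: "level_h_vector TYPE('k) [1, n, mp.dim (derivs n W), mp.dim W]"
  unfolding level_h_vector_def
proof (intro exI conjI)
  let ?h = "[1, n, mp.dim (derivs n W), mp.dim W]"
  have dim01: "mp.dim (forms n 0 :: 'k mpoly set) = 1" "mp.dim (forms n 1 :: 'k mpoly set) = n"
    unfolding dim_forms card_monoms_1 by (simp_all add: monoms_0)
  have "mp.dim (inv_sys i) = ?h ! i" if i4: "i < 4" for i
  proof -
    consider "i = 0" | "i = 1" | "i = 2" | "i = 3" using i4 by linarith
    then show ?thesis
      using dim01 by cases (simp_all add: inv_sys_def)
  qed
  moreover have "mp.dim (inv_sys i) = 0" if "4 \<le> i" for i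
    using that mp.dim_le_card[of "{0}" "{}"] by (simp add: inv_sys_def)
  ultimately have "has_dim n inv_ideal (graded_piece n inv_ideal i) (?h ! i)" if "i < 4" for i
    using has_dim_inv_sys[of i] that by simp
  moreover have "has_dim n inv_ideal (graded_piece n inv_ideal i) 0" if "4 \<le> i" for i
    using has_dim_inv_sys[of i] \<open>\<And>i. 4 \<le> i \<Longrightarrow> mp.dim (inv_sys i) = 0\<close>[OF that] by simp
  ultimately show "is_h_vector n inv_ideal ?h"
    using W(3) by (simp add: is_h_vector_def)
  have "p = 0" if "p \<in> inv_ideal" "p \<in> forms n 1" for p
  proof -
    have "p \<in> ann n 1 (inv_sys 1)" using that forms_inv_ideal by blast
    then have "pair p q = 0" if "q \<in> forms n 1" for q
      using that pair_commute[of p] by (auto simp: ann_def inv_sys_def)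
    then show ?thesis using pair_nondegenerate[OF that(2)] by blast
  qed
  then show "standard_graded_artinian n inv_ideal"
    using homogeneous_inv_ideal artinian_inv_ideal by (auto simp: standard_graded_artinian_def)
  have "has_dim n inv_ideal (quot_socle n inv_ideal) (mp.dim W)"
    using has_dim_inv_sys[of 3] unfolding socle_inv_ideal by (simp add: inv_sys_def)
  then show "level_algebra n inv_ideal (length ?h - 1) (last ?h)"
    by (simp add: level_algebra_def socle_inv_ideal numeral_3_eq_3)
qed

end

theorem corollary3p6:
  fixes r a t :: nat
  assumes "level_h_vector TYPE('k::field_char_0) [1, r, a, t]"
    and "real t \<ge> real r / 2"
  shows "\<forall>b. a \<le> b \<and> b \<le> min (t + 1) ((r + 1) choose 2) \<longrightarrow>
           level_h_vector TYPE('k) [1, r, b, t]"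
proof (intro allI impI)
  fix b assume b: "a \<le> b \<and> b \<le> min (t + 1) ((r + 1) choose 2)"
  obtain n and I :: "'k mpoly set" where I: "standard_graded_artinian n I"
    "is_h_vector n I [1, r, a, t]"
    "level_algebra n I (length [1, r, a, t] - 1) (last [1, r, a, t])"
    using assms(1) unfolding level_h_vector_def by blast
  have "level_algebra n I 3 t"
    using I(3) by (simp add: numeral_3_eq_3)
  then obtain W :: "'k mpoly set" where r: "r = n" and W: "mp.subspace W" "W \<subseteq> forms n 3"
    "mp.dim W = t" "0 < t" "mp.dim (derivs n W) = a" "derivs n (derivs n W) = forms n 1"
    by (rule level_inverse_system[OF I(1,2)])
  show "level_h_vector TYPE('k) [1, r, b, t]"
  \<comment> \<open>The interpolation requires a strict increase, since it starts from a square
    missing in \<open>derivs n W\<close>.\<close>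
  proof (cases "a = b")
    case True
    then show ?thesis using assms(1) by simp
  next
    case False
    have "0 < mp.dim W" "mp.dim (derivs n W) < b" "b \<le> mp.dim W + 1" using W b False by auto
    moreover have "b \<le> mp.dim (forms n 2 :: 'k mpoly set)"
      using b card_monoms_2[of n] unfolding dim_forms r by simp
    ultimately obtain W' where W': "mp.subspace W'" "W' \<subseteq> forms n 3" "mp.dim W' = mp.dim W"
      "mp.dim (derivs n W') = b" "derivs n W \<subseteq> derivs n W'"
      by (rule inverse_system_interpolation[OF W(1,2)])
    have "derivs n W' \<subseteq> forms n (Suc 1)"
      using derivs_subset[of W' n 2] W'(2) by (simp add: eval_nat_numeral)
    then have "derivs n (derivs n W') \<subseteq> forms n 1"
      by (rule derivs_subset)
    moreover have "forms n 1 \<subseteq> derivs n (derivs n W')"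
      using derivs_mono[OF W'(5), of n] unfolding W(6) .
    ultimately have "derivs n (derivs n W') = forms n 1" by (rule subset_antisym)
    then have "level_system n W'"
      using W'(1-3) W(3,4) by (intro level_system.intro) simp_all
    then show ?thesis
      using level_system.level_h_vector_inv_ideal[of n W'] W'(3,4) W(3) r by simp
  qed
qed

end
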